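(* Let $\lambda>0$, $\delta=1/M$ with $M\ge 2$ an integer, $\varphi\in(0,2\pi]$, $\alpha>2$, $P_t,\mathcal G_m,\ell>0$, $\omega:=P_t\,\mathcal G_m^2\,\ell$, and $\mathsf P_{\mathsf{fa}}\in(0,1)$. In the planar radar network described in the context, with the cone antenna pattern and with the aggregate interference replaced by the power $\mathcal I_s$ of the strongest interferer, the detection threshold $\Theta>0$ achieving false alarm probability $\mathsf P_{\mathsf{fa}}$, i.e. solving $\mathsf P_{\mathsf{fa}}=1-F_{\mathcal I_s}(\Theta)^{M-1}$ where $F_{\mathcal I_s}(i)=\mathbb P\{\mathcal I_s\le i\}$, is $$\Theta=\omega\left(\frac{-\Omega\,(1-\delta)\,\lambda\,\varphi^2}{4\pi\ln(1-\mathsf P_{\mathsf{fa}})}\right)^{\alpha/2},$$ where $\Omega=1$ in the no-fading case and $\Omega=\Gamma(1+2/\alpha)$ in the Rayleigh-fading case, $\Gamma$ being the Gamma function.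
   Context: Network model. Radar devices are located at the points of a homogeneous Poisson point process (PPP) $\Phi=\{\mathbf x_i\}$ of intensity $\lambda$ on $\mathbb R^2$. Time is slotted. Each device carries an independent mark $m_i$ uniform on $\{0,\dots,M-1\}$ and transmits a pulse exactly in the slots $m_i+kM$, $k\in\mathbb N$. The typical node (the receiver) is located at the origin, in addition to the points of $\Phi$; in each cycle of $M$ slots it transmits in one slot and listens in the other $M-1$ slots, called detection slots. In a given detection slot, the active interferers thus form a thinned version $\Phi_{\mathcal I}$ of $\Phi$ of intensity $\delta\lambda$. Antennas. Each device, including the typical node, has a boresight direction that is uniform on $[0,2\pi)$, independently of everything else. Cone antenna pattern: the antenna gain of a device is $\mathcal G_m$ in directions within its beam (the planar sector of angular width $\varphi$ centred on its boresight direction) and $0$ elsewhere. The paper sets $\mathcal G_m=4\pi/\varphi^2$. Received interference power. The power received at the typical node from an active interferer at $\mathbf x\in\Phi_{\mathcal I}$ is $P_t\,\mathcal G_t\,\mathcal G_r\,\ell\,\zeta_{\mathbf x}\,\|\mathbf x\|^{-\alpha}$, where $P_t$ is the transmit power, $\ell=[c/(4\pi f)]^2$ is a positive constant ($c$ the speed of light, $f$ the carrier frequency), $\mathcal G_t$ is the gain of the antenna of the device at $\mathbf x$ in the direction of the origin, and $\mathcal G_r$ is the gain of the antenna of the typical node in the direction of $\mathbf x$. In the no-fading case $\zeta_{\mathbf x}\equiv 1$; in the Rayleigh-fading case the $\zeta_{\mathbf x}$ are i.i.d. exponential random variables of mean $1$, independent of everything else. The power of the strongest interferer over a detection slot is $$\mathcal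 I_s=\sup_{\mathbf x\in\Phi_{\mathcal I}} P_t\,\mathcal G_t\,\mathcal G_r\,\ell\,\zeta_{\mathbf x}\,\|\mathbf x\|^{-\alpha}.$$ False alarm. A false alarm is the event that, in the absence of a target echo, the power in at least one of the $M-1$ detection slots exceeds $\Theta$; interference over the detection slots is i.i.d. and noise is disregarded, so under the strongest-interferer model its probability is $1-F_{\mathcal I_s}(\Theta)^{M-1}$. *)

theory Defs
  imports "HOL-Probability.Probability"
begin

section \<open>Homogeneous Poisson point process in the plane\<close>

definition num_points :: "(nat \<Rightarrow> 'w \<Rightarrow> real^2) \<Rightarrow> (real^2) set \<Rightarrow> 'w \<Rightarrow> nat" where
  "num_points X B w = card {i. X i w \<in> B}"

text \<open>
  The process is given by an enumeration \<open>X 0, X 1, \<dots>\<close> of its points. An infinite sequence is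
  adequate for intensity \<open>lam > 0\<close>, where there are almost surely infinitely many points.
  The Poisson probabilities are written out because \<open>poisson_pmf\<close> is only meaningful for a
  positive rate, whereas \<open>B\<close> may be a null set.
\<close>
definition homogeneous_ppp :: "'w measure \<Rightarrow> real \<Rightarrow> (nat \<Rightarrow> 'w \<Rightarrow> real^2) \<Rightarrow> bool" where
  "homogeneous_ppp P lam X \<longleftrightarrow>
     (\<forall>i. X i \<in> borel_measurable P) \<and>
     (\<forall>B\<in>sets borel. bounded B \<longrightarrow>
        (AE w in P. finite {i. X i w \<in> B}) \<and>
        (\<forall>k. measure P {w\<in>space P. num_points X B w = k} =
           exp (- (lam * measure lborel B)) * (lam * measure lborel B) ^ k / fact k)) \<and>
     (\<forall>B :: nat \<Rightarrow> (real^2) set.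
        (\<forall>j. B j \<in> sets borel \<and> bounded (B j)) \<and> disjoint_family B \<longrightarrow>
        prob_space.indep_vars P (\<lambda>_. count_space UNIV) (\<lambda>j. num_points X (B j)) UNIV)"


section \<open>The marked network\<close>

datatype fading = No_Fading | Rayleigh

fun fading_law :: "fading \<Rightarrow> real measure" where
  "fading_law No_Fading = return borel 1"
| "fading_law Rayleigh = density lborel (\<lambda>z. ennreal (exponential_density 1 z))"

definition boresight_law :: "real measure" where
  "boresight_law = uniform_measure lborel {0..<2*pi}"

text \<open>
  Device \<open>i\<close> is at \<open>X i\<close>, has slot mark \<open>mark i\<close>, boresight angle \<open>bs i\<close> and fading coefficient
  \<open>fade i\<close>; \<open>bs0\<close> is the boresight angle of the typical node at the origin.
  The equation on the joint law says that the sequences of marks, boresights and fading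
  coefficients are each i.i.d. with the stated law, and that these three sequences, \<open>bs0\<close> and the
  point process are mutually independent.
\<close>
locale radar_network = prob_space P
  for P :: "'w measure" +
  fixes lam :: real and M :: nat and fad :: fading
    and X :: "nat \<Rightarrow> 'w \<Rightarrow> real^2"
    and mark :: "nat \<Rightarrow> 'w \<Rightarrow> nat"
    and bs :: "nat \<Rightarrow> 'w \<Rightarrow> real"
    and fade :: "nat \<Rightarrow> 'w \<Rightarrow> real"
    and bs0 :: "'w \<Rightarrow> real"
  assumes ppp: "homogeneous_ppp P lam X"
    and mark_measurable: "\<And>i. mark i \<in> measurable P (count_space UNIV)"
    and bs_measurable: "\<And>i. bs i \<in> borel_measurable P"
    and fade_measurable: "\<And>i. fade i \<in> borel_measurable P"
    and bs0_measurable: "bs0 \<in> borel_measurable P"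
    and joint_law:
      "distr P
         ((\<Pi>\<^sub>M i\<in>UNIV. borel) \<Otimes>\<^sub>M (\<Pi>\<^sub>M i\<in>UNIV. count_space UNIV) \<Otimes>\<^sub>M
          (\<Pi>\<^sub>M i\<in>UNIV. borel) \<Otimes>\<^sub>M (\<Pi>\<^sub>M i\<in>UNIV. borel) \<Otimes>\<^sub>M borel)
         (\<lambda>w. (\<lambda>i. X i w, \<lambda>i. mark i w, \<lambda>i. bs i w, \<lambda>i. fade i w, bs0 w)) =
       distr P (\<Pi>\<^sub>M i\<in>UNIV. borel) (\<lambda>w i. X i w) \<Otimes>\<^sub>M
       (\<Pi>\<^sub>M i\<in>UNIV. measure_pmf (pmf_of_set {..<M})) \<Otimes>\<^sub>M
       (\<Pi>\<^sub>M i\<in>UNIV. boresight_law) \<Otimes>\<^sub>M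
       (\<Pi>\<^sub>M i\<in>UNIV. fading_law fad) \<Otimes>\<^sub>M
       boresight_law"

definition transmits_in :: "nat \<Rightarrow> nat \<Rightarrow> nat \<Rightarrow> bool" where
  "transmits_in M m s \<longleftrightarrow> (\<exists>k. s = m + k * M)"


section \<open>Cone antenna pattern and received power\<close>

definition direction :: "real \<Rightarrow> real^2" where
  "direction \<theta> = vector [cos \<theta>, sin \<theta>]"

definition sector :: "real \<Rightarrow> real \<Rightarrow> (real^2) set" where
  "sector \<phi> \<theta> = {r *\<^sub>R direction (\<theta> + t) | r t. 0 \<le> r \<and> \<bar>t\<bar> \<le> \<phi> / 2}"

definition cone_gain :: "real \<Rightarrow> real \<Rightarrow> real \<Rightarrow> real^2 \<Rightarrow> real" where
  "cone_gain Gm \<phi> \<theta> v = (if v \<in> sector \<phi> \<theta> then Gm else 0)"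

text \<open>
  Power received at the origin, with boresight \<open>\<theta>0\<close>, from an active device at \<open>x\<close> with boresight
  \<open>\<theta>\<close> and fading coefficient \<open>z\<close>: the origin is seen from \<open>x\<close> in the direction \<open>- x\<close>.
\<close>
definition received_power ::
  "real \<Rightarrow> real \<Rightarrow> real \<Rightarrow> real \<Rightarrow> real \<Rightarrow> real \<Rightarrow> real^2 \<Rightarrow> real \<Rightarrow> real \<Rightarrow> real" where
  "received_power Pt Gm l \<alpha> \<phi> \<theta>0 x \<theta> z =
     Pt * cone_gain Gm \<phi> \<theta> (- x) * cone_gain Gm \<phi> \<theta>0 x * l * z * norm x powr (- \<alpha>)"

context radar_network
begin

text \<open>Indices of the active interferers in slot \<open>s\<close>.\<close>
definition active :: "nat \<Rightarrow> 'w \<Rightarrow> nat set" where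
  "active s w = {i. transmits_in M (mark i w) s}"

text \<open>The supremum is taken in the extended reals, since a priori it need not be finite.\<close>
definition strongest_interference ::
  "real \<Rightarrow> real \<Rightarrow> real \<Rightarrow> real \<Rightarrow> real \<Rightarrow> nat \<Rightarrow> 'w \<Rightarrow> ereal" where
  "strongest_interference Pt Gm l \<alpha> \<phi> s w =
     (SUP i\<in>active s w.
        ereal (received_power Pt Gm l \<alpha> \<phi> (bs0 w) (X i w) (bs i w) (fade i w)))"

definition strongest_interference_cdf ::
  "real \<Rightarrow> real \<Rightarrow> real \<Rightarrow> real \<Rightarrow> real \<Rightarrow> nat \<Rightarrow> real \<Rightarrow> real" where
  "strongest_interference_cdf Pt Gm l \<alpha> \<phi> s x =
     prob {w\<in>space P. strongest_interference Pt Gm l \<alpha> \<phi> s w \<le> ereal x}"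

end

fun fading_const :: "real \<Rightarrow> fading \<Rightarrow> real" where
  "fading_const \<alpha> No_Fading = 1"
| "fading_const \<alpha> Rayleigh = Gamma (1 + 2 / \<alpha>)"

end

theory Submission
  imports Defs
begin

text \<open>
  An active device exceeds the threshold iff each of the two antenna beams covers the other device
  and the faded path loss is strong enough. Given the boresight of the receiver, the devices that
  exceed it form an independent thinning of the Poisson process, so by the probability generating
  functional there is none with probability \<open>exp (- \<Lambda>)\<close>, where \<open>\<Lambda>\<close> is the expected number of such
  devices. The marks contribute the factor \<open>1 / M\<close>, the boresight of the device \<open>\<phi> / (2 * pi)\<close>, and
  the receiver's sector of squared radius \<open>(\<omega> z / \<Theta>) powr (2 / \<alpha>)\<close>, averaged over the fading
  coefficient \<open>z\<close>, the area \<open>\<phi> / 2 * (\<omega> / \<Theta>) powr (2 / \<alpha>) * \<Omega>\<close>. This does not depend on the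
  receiver's boresight, and the equation for \<open>\<Theta>\<close> can be solved explicitly.
\<close>

section \<open>Geometry of planar sectors\<close>

lemma inner_direction: "x \<bullet> direction \<theta> = x $ 1 * cos \<theta> + x $ 2 * sin \<theta>"
  by (simp add: direction_def inner_vec_def sum_2)

lemma norm_direction [simp]: "norm (direction \<theta>) = 1"
  by (simp add: norm_eq_1 inner_direction) (simp add: direction_def flip: power2_eq_square)

lemma direction_inner_direction: "direction a \<bullet> direction b = cos (a - b)"
  by (simp add: inner_direction) (simp add: direction_def cos_diff)

text \<open>The window \<open>(pi, 3 * pi]\<close> is chosen so that the period centred at \<beta>
  starts at \<open>\<beta> - pi\<close>, a point of \<open>(0, 2 * pi]\<close>; comparing it with
  \<open>[0, 2 * pi)\<close> then takes a single wrap-around.\<close>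

lemma polar_decomposition:
  obtains \<beta> where "pi < \<beta>" "\<beta> \<le> 3 * pi" "x = norm x *\<^sub>R direction \<beta>"
proof -
  obtain r a where *: "x $ 1 = r * cos a" "x $ 2 = r * sin a"
    using polar_Ex by blast
  \<comment> \<open>The radius obtained from \<open>polar_Ex\<close> may be negative; a half turn of
    the angle makes it \<open>\<bar>r\<bar>\<close>.\<close>
  define b where "b = (if r \<ge> 0 then a else a + pi)"
  have x: "x = \<bar>r\<bar> *\<^sub>R direction b"
    using * by (simp add: vec_eq_iff forall_2 direction_def b_def)
  then have r: "\<bar>r\<bar> = norm x" by simp
  obtain y where y: "- pi < y" "y \<le> pi" "sin y = sin b" "cos y = cos b"
    using sincos_principal_value by blast
  have "direction (y + 2 * pi) = direction b" using y by (simp add: direction_def)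
  with x r that[of "y + 2 * pi"] y show thesis by simp
qed

text \<open>Cosine decreases on \<open>[0, pi]\<close> and \<open>\<phi> / 2 \<le> pi\<close>, so
  bounding the angle to the boresight from above amounts to bounding its cosine from below. The
  origin satisfies both sides. With the parameters \<open>r\<close> and \<open>t\<close> gone,
  measurability in point and boresight jointly is immediate.\<close>

lemma mem_sector_iff:
  assumes "0 < \<phi>" "\<phi> \<le> 2 * pi"
  shows "x \<in> sector \<phi> \<theta> \<longleftrightarrow> norm x * cos (\<phi> / 2) \<le> x \<bullet> direction \<theta>"
proof
  assume "x \<in> sector \<phi> \<theta>"
  then obtain r t where x: "x = r *\<^sub>R direction (\<theta> + t)" "0 \<le> r" "\<bar>t\<bar> \<le> \<phi> / 2"
    by (auto simp: sector_def)
  have "cos (\<phi> / 2) \<le> cos \<bar>t\<bar>"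
    using x assms by (intro cos_monotone_0_pi_le) auto
  then show "norm x * cos (\<phi> / 2) \<le> x \<bullet> direction \<theta>"
    using x by (auto simp: direction_inner_direction mult_left_mono)
next
  assume *: "norm x * cos (\<phi> / 2) \<le> x \<bullet> direction \<theta>"
  obtain \<beta> where x: "x = norm x *\<^sub>R direction \<beta>" using polar_decomposition by metis
  show "x \<in> sector \<phi> \<theta>"
  proof (cases "x = 0")
    case True
    then show ?thesis using assms by (auto simp: sector_def intro!: exI[of _ 0])
  next
    case False
    \<comment> \<open>The angle from the boresight to \<open>x\<close>, reduced to
      \<open>(-pi, pi]\<close> so that its absolute value lies where cosines can be
      compared.\<close>
    obtain t where t: "- pi < t" "t \<le> pi" "sin t = sin (\<beta> - \<theta>)" "cos t = cos (\<beta> - \<theta>)"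
      using sincos_principal_value by blast
    have "x \<bullet> direction \<theta> = norm x * cos t"
      by (subst x) (simp add: direction_inner_direction t)
    then have "cos (\<phi> / 2) \<le> cos \<bar>t\<bar>" using * False by simp
    then have "\<bar>t\<bar> \<le> \<phi> / 2"
      using t assms by (subst (asm) cos_mono_le_eq) auto
    moreover have "direction (\<theta> + t) = direction \<beta>"
      using t(3,4) cos_add[of \<theta> "\<beta> - \<theta>"] sin_add[of \<theta> "\<beta> - \<theta>"]
      by (simp add: direction_def cos_add sin_add)
    ultimately show ?thesis using x unfolding sector_def by (metis (mono_tags, lifting) mem_Collect_eq norm_ge_zero)
  qed
qed

lemma borel_measurable_direction [measurable]: "direction \<in> borel_measurable borel"
proof -
  have "(\<lambda>x. direction x $ i) \<in> borel_measurable borel" for i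
    using exhaust_2[of i] by (auto simp: direction_def)
  then show ?thesis
    by (subst borel_measurable_euclidean_space) (auto simp: Basis_vec_def inner_axis)
qed

lemma measurable_mem_sector [measurable]:
  assumes "0 < \<phi>" "\<phi> \<le> 2 * pi"
    and [measurable]: "f \<in> borel_measurable N" "g \<in> borel_measurable N"
  shows "Measurable.pred N (\<lambda>w. f w \<in> sector \<phi> (g w))"
  unfolding mem_sector_iff[OF assms(1,2)] by measurable

lemma sets_sector:
  assumes "0 < \<phi>" "\<phi> \<le> 2 * pi"
  shows "sector \<phi> \<theta> \<in> sets borel"
proof -
  have "{x. x \<in> sector \<phi> \<theta>} \<in> sets borel" using assms by measurable
  then show ?thesis by simp
qed

text \<open>
  The set of visible angles is periodic, so the period may be chosen to be centred at the
  direction of \<open>x\<close>, where the set is a single interval.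
\<close>
lemma emeasure_visible_angles:
  assumes \<phi>: "0 < \<phi>" "\<phi> \<le> 2 * pi" and "x \<noteq> 0"
  shows "emeasure lborel ({0..<2 * pi} \<inter> {t. x \<in> sector \<phi> t}) = ennreal \<phi>"
proof -
  obtain \<beta> where b: "pi < \<beta>" "\<beta> \<le> 3 * pi" "x = norm x *\<^sub>R direction \<beta>"
    using polar_decomposition by metis
  \<comment> \<open>\<open>a\<close> is the start of the period centred at \<beta>, and
    \<open>h\<close> is half the beam width.\<close>
  define a h where "a = \<beta> - pi" and "h = \<phi> / 2"
  have h: "0 < h" "h \<le> pi" using \<phi> by (auto simp: h_def)
  define S where "S = {t. x \<in> sector \<phi> t}"
  have S: "t \<in> S \<longleftrightarrow> cos h \<le> cos (t - \<beta>)" for t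
  proof -
    have "x \<bullet> direction t = norm x * cos (t - \<beta>)"
      by (subst b(3)) (simp add: direction_inner_direction cos_diff)
    then show ?thesis using \<open>x \<noteq> 0\<close> by (simp add: S_def mem_sector_iff[OF \<phi>] h_def)
  qed
  have [measurable]: "S \<in> sets borel"
    using \<phi> unfolding S_def by measurable
  have a: "0 \<le> a" "a \<le> 2 * pi" using b by (auto simp: a_def)
  have shift: "emeasure lborel (S \<inter> {0..<a}) = emeasure lborel (S \<inter> {2*pi..<2*pi + a})"
  proof -
    have "emeasure lborel (S \<inter> {2*pi..<2*pi + a}) =
        emeasure (distr lborel borel ((+) (2*pi))) (S \<inter> {2*pi..<2*pi + a})"
      by (simp add: lborel_distr_plus)
    also have "\<dots> = emeasure lborel ((+) (2*pi) -` (S \<inter> {2*pi..<2*pi + a}))"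
      by (subst emeasure_distr) auto
    also have "(+) (2*pi) -` (S \<inter> {2*pi..<2*pi + a}) = S \<inter> {0..<a}"
    proof -
      have "cos (2 * pi + t - \<beta>) = cos (t - \<beta>)" for t
        using cos_periodic[of "t - \<beta>"] by (simp add: algebra_simps)
      then show ?thesis by (auto simp: S)
    qed
    finally show ?thesis by simp
  qed
  \<comment> \<open>Cutting \<open>[0, 2 * pi)\<close> at \<open>a\<close> and moving the left piece
    up by a full period produces \<open>[a, a + 2 * pi)\<close>.\<close>
  have "emeasure lborel ({0..<2 * pi} \<inter> S) = emeasure lborel ((S \<inter> {0..<a}) \<union> (S \<inter> {a..<2*pi}))"
    using a by (intro arg_cong[where f="emeasure lborel"]) auto
  also have "\<dots> = emeasure lborel (S \<inter> {0..<a}) + emeasure lborel (S \<inter> {a..<2*pi})"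
    by (intro plus_emeasure[symmetric]) auto
  also have "\<dots> = emeasure lborel (S \<inter> {a..<2*pi}) + emeasure lborel (S \<inter> {2*pi..<2*pi + a})"
    unfolding shift by (simp add: add.commute)
  also have "\<dots> = emeasure lborel ((S \<inter> {a..<2*pi}) \<union> (S \<inter> {2*pi..<2*pi + a}))"
    by (intro plus_emeasure) auto
  also have "(S \<inter> {a..<2*pi}) \<union> (S \<inter> {2*pi..<2*pi + a}) = S \<inter> {a..<a + 2*pi}"
    using a by auto
  also have "emeasure lborel \<dots> = ennreal \<phi>"
  proof (rule antisym)
    have S': "t \<in> S \<longleftrightarrow> \<bar>t - \<beta>\<bar> \<le> h" if "t \<in> {a..<a + 2*pi}" for t
    proof -
      have "cos (t - \<beta>) = cos \<bar>t - \<beta>\<bar>" by simp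
      moreover have "\<bar>t - \<beta>\<bar> \<le> pi" using that by (auto simp: a_def)
      ultimately show ?thesis using h unfolding S by (metis abs_ge_zero cos_mono_le_eq less_eq_real_def)
    qed
    have "S \<inter> {a..<a + 2*pi} \<subseteq> {\<beta> - h..\<beta> + h}" using S' by force
    then have "emeasure lborel (S \<inter> {a..<a + 2*pi}) \<le> emeasure lborel {\<beta> - h..\<beta> + h}"
      by (intro emeasure_mono) auto
    then show "emeasure lborel (S \<inter> {a..<a + 2*pi}) \<le> ennreal \<phi>" using h by (simp add: h_def)
    \<comment> \<open>The right endpoint is left out: for \<open>\<phi> = 2 * pi\<close> it equals
      \<open>a + 2 * pi\<close>, which is outside the period.\<close>
    have "{\<beta> - h..<\<beta> + h} \<subseteq> S \<inter> {a..<a + 2*pi}"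
    proof
      fix t assume t: "t \<in> {\<beta> - h..<\<beta> + h}"
      then have "t \<in> {a..<a + 2*pi}" using h by (auto simp: a_def)
      with t S' show "t \<in> S \<inter> {a..<a + 2*pi}" by force
    qed
    then have "emeasure lborel {\<beta> - h..<\<beta> + h} \<le> emeasure lborel (S \<inter> {a..<a + 2*pi})"
      by (intro emeasure_mono) auto
    then show "ennreal \<phi> \<le> emeasure lborel (S \<inter> {a..<a + 2*pi})" using h by (simp add: h_def)
  qed
  finally show ?thesis by (simp add: S_def)
qed

section \<open>Rotations and the area of a circular sector\<close>

definition rotation :: "real \<Rightarrow> real^2 \<Rightarrow> real^2" where
  "rotation \<theta> x = vector [cos \<theta> * x $ 1 - sin \<theta> * x $ 2, sin \<theta> * x $ 1 + cos \<theta> * x $ 2]"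

lemma orthogonal_transformation_rotation: "orthogonal_transformation (rotation \<theta>)"
proof -
  have "linear (rotation \<theta>)"
    by (rule linearI) (simp_all add: rotation_def vec_eq_iff forall_2 algebra_simps)
  moreover have "rotation \<theta> x \<bullet> rotation \<theta> y = x \<bullet> y" for x y
  proof -
    have "rotation \<theta> x \<bullet> rotation \<theta> y = ((sin \<theta>)\<^sup>2 + (cos \<theta>)\<^sup>2) * (x $ 1 * y $ 1 + x $ 2 * y $ 2)"
      by (simp add: rotation_def inner_vec_def sum_2 power2_eq_square algebra_simps
          del: sin_cos_squared_add sin_cos_squared_add2 sin_cos_squared_add3)
    then show ?thesis by (simp add: inner_vec_def sum_2)
  qed
  ultimately show ?thesis by (simp add: orthogonal_transformation_def)
qed

lemma rotation_sector: "rotation \<theta> ` sector \<phi> 0 = sector \<phi> \<theta>"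
proof -
  have *: "rotation \<theta> (r *\<^sub>R direction t) = r *\<^sub>R direction (\<theta> + t)" for r t
    by (simp add: rotation_def direction_def vec_eq_iff forall_2 cos_add sin_add algebra_simps)
  have "sector \<phi> \<theta> = (\<lambda>(r, t). r *\<^sub>R direction (\<theta> + t)) ` {(r, t). 0 \<le> r \<and> \<bar>t\<bar> \<le> \<phi> / 2}" for \<theta>
    by (auto simp: sector_def)
  then show ?thesis by (simp add: image_image * case_prod_beta)
qed

text \<open>
  Polar coordinates are avoided: by rotation invariance the area does not depend on \<open>\<theta>\<close>, and its
  average over \<open>\<theta>\<close> is computed with Fubini's theorem from the measure of the visible angles.
\<close>
lemma emeasure_sector_Int_ball:
  assumes \<phi>: "0 < \<phi>" "\<phi> \<le> 2 * pi" and r: "0 \<le> r"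
  shows "emeasure lborel (sector \<phi> \<theta> \<inter> ball 0 r) = ennreal (\<phi> / 2 * r\<^sup>2)"
proof -
  define A where "A \<theta> = sector \<phi> \<theta> \<inter> ball 0 r" for \<theta>
  have mem_A: "x \<in> A \<theta> \<longleftrightarrow> x \<in> sector \<phi> \<theta> \<and> norm x < r" for x \<theta>
    by (simp add: A_def)
  have A [measurable]: "A \<theta> \<in> sets borel" for \<theta>
  proof -
    have "{x. x \<in> sector \<phi> \<theta> \<and> norm x < r} \<in> sets borel"
      using \<phi> by measurable
    then show ?thesis by (simp flip: mem_A)
  qed
  \<comment> \<open>Invariance under orthogonal maps is applied to Lebesgue measure, hence the
    passage from \<open>lborel\<close> to \<open>lebesgue\<close> and back.\<close>
  have lm: "A \<theta> \<in> lmeasurable" for \<theta>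
  proof (rule bounded_set_imp_lmeasurable)
    show "bounded (A \<theta>)" by (simp add: A_def bounded_Int)
    show "A \<theta> \<in> sets lebesgue" using A[of \<theta>] by (metis sets_completionI_sets sets_lborel)
  qed
  have A_rotation: "A \<theta> = rotation \<theta> ` A 0" for \<theta>
    unfolding A_def
    by (simp add: image_Int orthogonal_transformation_inj orthogonal_transformation_rotation rotation_sector
        image_orthogonal_transformation_ball orthogonal_transformation_linear linear_0)
  have em: "emeasure lborel (A \<theta>) = emeasure lborel (A 0)" for \<theta>
  proof -
    have "measure lebesgue (A \<theta>) = measure lebesgue (A 0)"
      using measure_orthogonal_image[OF orthogonal_transformation_rotation lm] A_rotation by metis
    then have "emeasure lebesgue (A \<theta>) = emeasure lebesgue (A 0)"
      using lm by (simp add: emeasure_eq_measure2)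
    then show ?thesis by simp
  qed
  have "2 * pi * emeasure lborel (A 0) =
      (\<integral>\<^sup>+t. emeasure lborel (A t) * indicator {0..<2*pi} t \<partial>lborel)"
    by (subst em) (simp add: nn_integral_cmult mult.commute ennreal_mult)
  also have "\<dots> = (\<integral>\<^sup>+t. \<integral>\<^sup>+x. indicator (A t) x * indicator {0..<2*pi} t \<partial>lborel \<partial>lborel)"
    by (intro nn_integral_cong) (simp add: nn_integral_multc)
  also have "\<dots> = (\<integral>\<^sup>+x. \<integral>\<^sup>+t. indicator (A t) x * indicator {0..<2*pi} t \<partial>lborel \<partial>lborel)"
    using \<phi> unfolding indicator_def of_bool_def mem_A by (intro lborel_pair.Fubini'[symmetric]) measurable
  also have "\<dots> = (\<integral>\<^sup>+x. ennreal \<phi> * indicator (ball (0 :: real^2) r) x \<partial>lborel)"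
  proof (rule nn_integral_cong_AE)
    \<comment> \<open>The origin lies in every sector, so its visible angles have measure
      \<open>2 * pi\<close> instead of \<phi>; it is discarded as a null set.\<close>
    have "AE x in lborel. x \<noteq> (0 :: real^2)"
      by (rule AE_lborel_singleton)
    then show "AE x in lborel. (\<integral>\<^sup>+t. indicator (A t) x * indicator {0..<2*pi} t \<partial>lborel) =
        ennreal \<phi> * indicator (ball 0 r) x"
    proof eventually_elim
      case (elim x)
      have [measurable]: "{0..<2*pi} \<inter> {t. x \<in> sector \<phi> t} \<in> sets borel"
        using \<phi> by measurable
      have "(\<integral>\<^sup>+t. indicator (A t) x * indicator {0..<2*pi} t \<partial>lborel) =
          (\<integral>\<^sup>+t. indicator (ball 0 r) x * indicator ({0..<2*pi} \<inter> {t. x \<in> sector \<phi> t}) t \<partial>lborel)"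
        by (intro nn_integral_cong) (auto simp: A_def split: split_indicator)
      also have "\<dots> = indicator (ball 0 r) x * ennreal \<phi>"
        by (subst nn_integral_cmult_indicator) (auto simp: emeasure_visible_angles[OF \<phi> elim])
      finally show ?case by (simp add: mult.commute)
    qed
  qed
  \<comment> \<open>\<phi> times the area of the disc, regrouped so that the factor
    \<open>2 * pi\<close> of the average over angles cancels.\<close>
  also have "\<dots> = ennreal (2 * pi) * ennreal (\<phi> / 2 * r\<^sup>2)"
    using r \<phi> by (simp add: nn_integral_cmult_indicator emeasure_ball unit_ball_vol_2 flip: ennreal_mult)
  finally have "ennreal (2 * pi) * emeasure lborel (A 0) = ennreal (2 * pi) * ennreal (\<phi> / 2 * r\<^sup>2)"
    by (simp add: ennreal_mult)
  then show ?thesis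
    using em[of \<theta>] by (simp add: ennreal_mult_cancel_left A_def)
qed

section \<open>The generating functional of a Poisson process\<close>

lemma INF_eq_limit:
  fixes f :: "nat \<Rightarrow> 'a :: {complete_linorder, linorder_topology}"
  assumes "decseq f" "f \<longlonglongrightarrow> l"
  shows "(INF n. f n) = l"
  using LIMSEQ_INF[OF assms(1)] assms(2) by (rule LIMSEQ_unique)

lemma decseq_prod_ennreal:
  fixes f :: "nat \<Rightarrow> ennreal"
  assumes "\<And>i. f i \<le> 1"
  shows "decseq (\<lambda>n. \<Prod>i<n. f i)"
proof (rule decseq_SucI)
  show "(\<Prod>i<Suc n. f i) \<le> (\<Prod>i<n. f i)" for n
    using mult_left_mono[OF assms[of n], of "\<Prod>i<n. f i"] by simp
qed

text \<open>Probability generating function of a Poisson variable: summing over the values of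
  \<open>N\<close> gives the exponential series at \<open>\<mu> * q\<close>. Rate 0 is included,
  since a level set may be null.\<close>

lemma nn_integral_power_poisson:
  assumes "prob_space P" and [measurable]: "N \<in> measurable P (count_space UNIV)"
    and law: "\<And>k. measure P {w \<in> space P. N w = k} = exp (- \<mu>) * \<mu> ^ k / fact k"
    and "0 \<le> \<mu>" "0 \<le> q"
  shows "(\<integral>\<^sup>+w. ennreal (q ^ N w) \<partial>P) = ennreal (exp (- (\<mu> * (1 - q))))"
proof -
  interpret prob_space P by fact
  have "(\<integral>\<^sup>+w. ennreal (q ^ N w) \<partial>P) =
      (\<integral>\<^sup>+w. (\<Sum>k. ennreal (q ^ k) * indicator {w \<in> space P. N w = k} w) \<partial>P)"
    by (intro nn_integral_cong suminf_cmult_indicator[symmetric]) (auto simp: disjoint_family_on_def)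
  also have "\<dots> = (\<Sum>k. \<integral>\<^sup>+w. ennreal (q ^ k) * indicator {w \<in> space P. N w = k} w \<partial>P)"
    by (intro nn_integral_suminf) measurable
  also have "\<dots> = (\<Sum>k. ennreal (exp (- \<mu>) * ((\<mu> * q) ^ k / fact k)))"
    using \<open>0 \<le> \<mu>\<close> \<open>0 \<le> q\<close>
    by (intro suminf_cong, subst nn_integral_cmult_indicator)
      (auto simp: emeasure_eq_measure law power_mult_distrib mult_ac simp flip: ennreal_mult)
  also have "\<dots> = ennreal (exp (- \<mu>) * exp (\<mu> * q))"
    using \<open>0 \<le> \<mu>\<close> \<open>0 \<le> q\<close> exp_converges[of "\<mu> * q"]
    by (intro suminf_ennreal_eq sums_mult) (auto simp: divide_inverse mult_ac)
  finally show ?thesis by (simp add: algebra_simps flip: exp_add)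
qed

lemma homogeneous_ppp_measurable:
  "homogeneous_ppp P lam X \<Longrightarrow> X i \<in> borel_measurable P"
  by (simp add: homogeneous_ppp_def)

text \<open>
  The infinite product over the points is encoded as the infimum of the finite products. For simple
  \<open>p\<close> of bounded support it only involves the Poisson counts of the level sets of \<open>p\<close>.
\<close>
lemma ppp_generating_functional_simple:
  assumes "prob_space P" and ppp: "homogeneous_ppp P lam X" and "0 \<le> lam"
    and p: "simple_function borel p" "\<And>x. 0 \<le> p x" "\<And>x. p x \<le> 1" "bounded {x. p x \<noteq> 0}"
  shows "(INF n. \<integral>\<^sup>+w. (\<Prod>i<n. ennreal (1 - p (X i w))) \<partial>P) =
    ennreal (exp (- (lam * enn2real (\<integral>\<^sup>+x. ennreal (p x) \<partial>lborel))))"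
proof -
  interpret prob_space P by fact
  have [measurable]: "X i \<in> borel_measurable P" for i
    using ppp by (rule homogeneous_ppp_measurable)
  have [measurable]: "p \<in> borel_measurable borel"
    using p(1) by (rule borel_measurable_simple_function)
  \<comment> \<open>Points with \<open>p = 0\<close> contribute the factor 1. The level sets of the
    other values lie in the bounded support of \<open>p\<close>, where the Poisson counts are
    available.\<close>
  define Y where "Y = range p - {0}"
  define B where "B y = p -` {y}" for y
  have Y: "finite Y" using p(1) by (simp add: simple_function_def Y_def)
  have [measurable]: "B y \<in> sets borel" for y
    using measurable_sets[of p borel borel "{y}"] by (simp add: B_def)
  have B_bounded: "bounded (B y)" if "y \<in> Y" for y
    by (rule bounded_subset[OF p(4)]) (use that in \<open>auto simp: B_def Y_def\<close>)
  have Y01: "0 \<le> y" "y \<le> 1" if "y \<in> Y" for y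
    using that p by (auto simp: Y_def)

  obtain e where e: "bij_betw e {..<card Y} Y"
    using ex_bij_betw_nat_finite[OF Y] by (auto simp: lessThan_atLeast0)
  \<comment> \<open>Independence in \<open>homogeneous_ppp\<close> concerns infinite sequences of
    sets, so the finite family of level sets is padded with empty sets.\<close>
  define B' where "B' j = (if j < card Y then B (e j) else {})" for j
  have "disjoint_family B'"
    using bij_betw_imp_inj_on[OF e] by (auto simp: disjoint_family_on_def B'_def B_def inj_on_def)
  moreover have "B' j \<in> sets borel" "bounded (B' j)" for j
    using bij_betwE[OF e] by (auto simp: B'_def intro: B_bounded)
  ultimately have "indep_vars (\<lambda>_. count_space UNIV) (\<lambda>j. num_points X (B' j)) UNIV"
    using ppp by (auto simp: homogeneous_ppp_def)
  then have "indep_vars (\<lambda>_. count_space UNIV) (\<lambda>j. num_points X (B' j)) {..<card Y}"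
    by (rule indep_vars_subset) simp
  also have "?this \<longleftrightarrow> indep_vars (\<lambda>_. count_space UNIV) (\<lambda>j. num_points X (B (e j))) {..<card Y}"
    by (intro indep_vars_cong) (auto simp: B'_def)
  finally have indep: \<dots> .

  have factor: "(\<integral>\<^sup>+w. ennreal ((1 - y) ^ num_points X (B y) w) \<partial>P) =
      ennreal (exp (- (lam * (y * measure lborel (B y)))))" if "y \<in> Y" for y
  proof -
    from that obtain j where "j < card Y" "e j = y"
      using e by (metis bij_betw_def imageE lessThan_iff)
    \<comment> \<open>Measurability of the counts is part of \<open>indep_vars\<close>.\<close>
    with indep have "num_points X (B y) \<in> measurable P (count_space UNIV)"
      by (auto simp: indep_vars_def)
    moreover have "measure P {w\<in>space P. num_points X (B y) w = k} =
           exp (- (lam * measure lborel (B y))) * (lam * measure lborel (B y)) ^ k / fact k" for k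
      using ppp B_bounded[OF that] by (auto simp: homogeneous_ppp_def)
    ultimately show ?thesis
      using nn_integral_power_poisson[OF prob_space_axioms, of "num_points X (B y)" "lam * measure lborel (B y)" "1 - y"]
        Y01[OF that] \<open>0 \<le> lam\<close> by (simp add: mult_ac)
  qed

  have "AE w in P. \<forall>y\<in>Y. finite {i. X i w \<in> B y}"
    using ppp B_bounded Y by (intro AE_finite_allI) (auto simp: homogeneous_ppp_def)
  \<comment> \<open>Almost surely only finitely many points have \<open>p \<noteq> 0\<close>. The
    partial products are then eventually constant, and grouping the factors by the value
    \<open>y\<close> leaves one power of \<open>1 - y\<close> per level set.\<close>
  then have pointwise: "AE w in P. (INF n. \<Prod>i<n. ennreal (1 - p (X i w))) =
      (\<Prod>y\<in>Y. ennreal ((1 - y) ^ num_points X (B y) w))"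
  proof eventually_elim
    case (elim w)
    define S where "S = {i. p (X i w) \<noteq> 0}"
    have "S = (\<Union>y\<in>Y. {i. X i w \<in> B y})" by (auto simp: S_def Y_def B_def)
    then have S: "finite S" using elim Y by simp
    have "(INF n. \<Prod>i<n. ennreal (1 - p (X i w))) = (\<Prod>i\<in>S. ennreal (1 - p (X i w)))"
    proof (rule INF_eq_limit[OF decseq_prod_ennreal tendsto_eventually])
      show "ennreal (1 - p (X i w)) \<le> 1" for i using p by simp
      obtain m where m: "S \<subseteq> {..<m}" using S finite_nat_iff_bounded by blast
      show "\<forall>\<^sub>F n in sequentially. (\<Prod>i<n. ennreal (1 - p (X i w))) = (\<Prod>i\<in>S. ennreal (1 - p (X i w)))"
        using eventually_ge_at_top[of m]
      proof eventually_elim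
        case (elim n)
        then have "S \<subseteq> {..<n}" using m by auto
        then show ?case by (intro prod.mono_neutral_right) (auto simp: S_def)
      qed
    qed
    also have "\<dots> = (\<Prod>y\<in>Y. \<Prod>i\<in>{i \<in> S. p (X i w) = y}. ennreal (1 - p (X i w)))"
      using S Y by (intro prod.group[symmetric]) (auto simp: S_def Y_def)
    also have "\<dots> = (\<Prod>y\<in>Y. ennreal ((1 - y) ^ num_points X (B y) w))"
    proof (intro prod.cong refl)
      fix y assume "y \<in> Y"
      have "{i \<in> S. p (X i w) = y} = {i. X i w \<in> B y}"
        using \<open>y \<in> Y\<close> by (auto simp: S_def Y_def B_def)
      then have "card {i \<in> S. p (X i w) = y} = num_points X (B y) w"
        by (simp add: num_points_def)
      then show "(\<Prod>i\<in>{i \<in> S. p (X i w) = y}. ennreal (1 - p (X i w))) = ennreal ((1 - y) ^ num_points X (B y) w)"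
        using Y01[OF \<open>y \<in> Y\<close>] by (simp flip: ennreal_power)
    qed
    finally show ?case .
  qed

  have "(INF n. \<integral>\<^sup>+w. (\<Prod>i<n. ennreal (1 - p (X i w))) \<partial>P) =
      (\<integral>\<^sup>+w. (INF n. \<Prod>i<n. ennreal (1 - p (X i w))) \<partial>P)"
  proof (rule nn_integral_monotone_convergence_INF_AE[symmetric])
    show "AE w in P. (\<Prod>i<Suc n. ennreal (1 - p (X i w))) \<le> (\<Prod>i<n. ennreal (1 - p (X i w)))" for n
      using p by (intro AE_I2 decseqD[OF decseq_prod_ennreal]) auto
    show "(\<integral>\<^sup>+w. (\<Prod>i<0. ennreal (1 - p (X i w))) \<partial>P) < \<infinity>" by (simp add: emeasure_space_1)
  qed measurable
  also have "\<dots> = (\<integral>\<^sup>+w. (\<Prod>y\<in>Y. ennreal ((1 - y) ^ num_points X (B y) w)) \<partial>P)"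
    by (rule nn_integral_cong_AE[OF pointwise])
  also have "\<dots> = (\<integral>\<^sup>+w. (\<Prod>j<card Y. ennreal ((1 - e j) ^ num_points X (B (e j)) w)) \<partial>P)"
    by (intro nn_integral_cong prod.reindex_bij_betw[OF e, symmetric])
  also have "\<dots> = (\<Prod>j<card Y. \<integral>\<^sup>+w. ennreal ((1 - e j) ^ num_points X (B (e j)) w) \<partial>P)"
    by (intro indep_vars_nn_integral indep_vars_compose2[OF indep]) auto
  also have "\<dots> = (\<Prod>y\<in>Y. \<integral>\<^sup>+w. ennreal ((1 - y) ^ num_points X (B y) w) \<partial>P)"
    by (rule prod.reindex_bij_betw[OF e])
  also have "\<dots> = (\<Prod>y\<in>Y. ennreal (exp (- (lam * (y * measure lborel (B y))))))"
    using factor by (intro prod.cong) auto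
  also have "\<dots> = ennreal (exp (- (lam * (\<Sum>y\<in>Y. y * measure lborel (B y)))))"
    by (simp add: prod_ennreal sum_distrib_left exp_sum[OF Y] flip: sum_negf)
  also have "(\<Sum>y\<in>Y. y * measure lborel (B y)) = enn2real (\<integral>\<^sup>+x. ennreal (p x) \<partial>lborel)"
  proof -
    have "(\<integral>\<^sup>+x. ennreal (p x) \<partial>lborel) = (\<integral>\<^sup>+x. (\<Sum>y\<in>Y. ennreal y * indicator (B y) x) \<partial>lborel)"
    proof (intro nn_integral_cong)
      fix x
      have "(\<Sum>y\<in>Y. ennreal y * indicator (B y) x) = (\<Sum>y\<in>Y. if y = p x then ennreal y else 0)"
        by (intro sum.cong) (auto simp: B_def)
      then show "ennreal (p x) = (\<Sum>y\<in>Y. ennreal y * indicator (B y) x)"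
        using Y by (auto simp: Y_def)
    qed
    also have "\<dots> = (\<Sum>y\<in>Y. ennreal y * emeasure lborel (B y))"
      by (subst nn_integral_sum) (auto simp: nn_integral_cmult_indicator)
    also have "\<dots> = (\<Sum>y\<in>Y. ennreal (y * measure lborel (B y)))"
      using Y01 emeasure_bounded_finite[OF B_bounded]
      by (intro sum.cong) (auto simp: ennreal_mult emeasure_eq_ennreal_measure less_top)
    also have "\<dots> = ennreal (\<Sum>y\<in>Y. y * measure lborel (B y))"
      using Y01 by (intro sum_ennreal) auto
    finally show ?thesis using Y01 by (simp add: sum_nonneg)
  qed
  finally show ?thesis .
qed

text \<open>Approximate \<open>p\<close> from below by simple functions of bounded support; both
  sides decrease along the approximation and pass to the limit. Finiteness of the integral matters
  because \<open>enn2real\<close> sends \<infinity> to 0.\<close>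

lemma ppp_generating_functional:
  assumes "prob_space P" and ppp: "homogeneous_ppp P lam X" and "0 \<le> lam"
    and p [measurable]: "p \<in> borel_measurable borel" and p01: "\<And>x. 0 \<le> p x" "\<And>x. p x \<le> 1"
    and fin: "(\<integral>\<^sup>+x. ennreal (p x) \<partial>lborel) < \<infinity>"
  shows "(INF n. \<integral>\<^sup>+w. (\<Prod>i<n. ennreal (1 - p (X i w))) \<partial>P) =
    ennreal (exp (- (lam * enn2real (\<integral>\<^sup>+x. ennreal (p x) \<partial>lborel))))"
proof -
  interpret prob_space P by fact
  have [measurable]: "X i \<in> borel_measurable P" for i
    using ppp by (rule homogeneous_ppp_measurable)
  obtain s where s: "incseq s" "\<And>k. simple_function borel (s k)" "\<And>x. bdd_above (range (\<lambda>k. s k x))"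
      "\<And>k x. 0 \<le> s k x" "p = (SUP k. s k)"
    using borel_measurable_implies_simple_function_sequence_real[OF p p01(1)] by blast
  \<comment> \<open>Cutting off outside a growing ball makes the support bounded and preserves
    monotone convergence to \<open>p\<close>.\<close>
  define q where "q k x = s k x * indicator (ball 0 (real k)) x" for k x
  have incseq_s: "incseq (\<lambda>k. s k x)" for x
    using s(1) by (auto simp: incseq_def le_fun_def)
  have SUP_s: "p x = (SUP k. s k x)" for x by (simp add: s(5) image_comp)
  have s_le: "s k x \<le> p x" for k x
    unfolding SUP_s using s(3) by (intro cSUP_upper) auto
  have q_le: "q k x \<le> p x" and q_nonneg: "0 \<le> q k x" and q_le1: "q k x \<le> 1" for k x
    using s_le[of k x] s(4)[of k x] p01[of x] by (auto simp: q_def split: split_indicator)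
  have q_mono: "q k x \<le> q (Suc k) x" for k x
    using incseq_SucD[OF incseq_s, of k x] s(4)[of "Suc k" x] by (auto simp: q_def split: split_indicator)
  have q_lim: "(\<lambda>k. q k x) \<longlonglongrightarrow> p x" for x
  proof -
    have "(\<lambda>k. s k x) \<longlonglongrightarrow> p x"
      unfolding SUP_s by (intro LIMSEQ_incseq_SUP s(3) incseq_s)
    moreover obtain m where "norm x < real m" using reals_Archimedean2 by blast
    then have "\<forall>\<^sub>F k in sequentially. s k x = q k x"
      by (intro eventually_sequentiallyI[of m]) (auto simp: q_def)
    ultimately show ?thesis by (rule Lim_transform_eventually)
  qed
  have q_simple: "simple_function borel (q k)" for k
    unfolding q_def by (intro simple_function_mult s(2) simple_function_indicator) auto
  have [measurable]: "q k \<in> borel_measurable borel" for k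
    using q_simple by (rule borel_measurable_simple_function)
  have q_bounded: "bounded {x. q k x \<noteq> 0}" for k
    by (rule bounded_subset[OF bounded_ball[of 0 "real k"]]) (auto simp: q_def split: split_indicator_asm)
  let ?c = "\<lambda>p. \<integral>\<^sup>+x. ennreal (p x) \<partial>lborel"

  have outer: "(\<integral>\<^sup>+w. (\<Prod>i<n. ennreal (1 - p (X i w))) \<partial>P) =
      (INF k. \<integral>\<^sup>+w. (\<Prod>i<n. ennreal (1 - q k (X i w))) \<partial>P)" for n
  proof -
    have dec: "decseq (\<lambda>k. \<Prod>i<n. ennreal (1 - q k (X i w)))" for w
      using q_mono by (intro decseq_SucI prod_mono_ennreal) (auto intro: ennreal_leI)
    have "(\<Prod>i<n. ennreal (1 - p (X i w))) = (INF k. \<Prod>i<n. ennreal (1 - q k (X i w)))" for w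
    proof (rule INF_eq_limit[OF dec, symmetric])
      have "(\<lambda>k. ennreal (\<Prod>i<n. 1 - q k (X i w))) \<longlonglongrightarrow> ennreal (\<Prod>i<n. 1 - p (X i w))"
        by (intro tendsto_ennrealI tendsto_prod tendsto_diff tendsto_const q_lim)
      then show "(\<lambda>k. \<Prod>i<n. ennreal (1 - q k (X i w))) \<longlonglongrightarrow> (\<Prod>i<n. ennreal (1 - p (X i w)))"
        using q_le1 p01(2) by (simp add: prod_ennreal)
    qed
    then have "(\<integral>\<^sup>+w. (\<Prod>i<n. ennreal (1 - p (X i w))) \<partial>P) =
        (\<integral>\<^sup>+w. (INF k. \<Prod>i<n. ennreal (1 - q k (X i w))) \<partial>P)"
      by simp
    also have "\<dots> = (INF k. \<integral>\<^sup>+w. (\<Prod>i<n. ennreal (1 - q k (X i w))) \<partial>P)"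
    proof (rule nn_integral_monotone_convergence_INF_AE)
      show "AE w in P. (\<Prod>i<n. ennreal (1 - q (Suc k) (X i w))) \<le> (\<Prod>i<n. ennreal (1 - q k (X i w)))" for k
        using decseq_SucD[OF dec] by simp
      have "(\<integral>\<^sup>+w. (\<Prod>i<n. ennreal (1 - q 0 (X i w))) \<partial>P) \<le> (\<integral>\<^sup>+w. 1 \<partial>P)"
        using q_nonneg by (intro nn_integral_mono prod_le_1) auto
      then show "(\<integral>\<^sup>+w. (\<Prod>i<n. ennreal (1 - q 0 (X i w))) \<partial>P) < \<infinity>"
        by (simp add: emeasure_space_1 order_le_less_trans)
    qed measurable
    finally show ?thesis .
  qed
  \<comment> \<open>The limits in the number of points and in the approximation are both written as
    infima, and infima commute.\<close>
  have "(INF n. \<integral>\<^sup>+w. (\<Prod>i<n. ennreal (1 - p (X i w))) \<partial>P) =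
      (INF k. INF n. \<integral>\<^sup>+w. (\<Prod>i<n. ennreal (1 - q k (X i w))) \<partial>P)"
    unfolding outer by (rule INF_commute)
  also have "\<dots> = (INF k. ennreal (exp (- (lam * enn2real (?c (q k))))))"
    using ppp_generating_functional_simple[OF assms(1-3) q_simple q_nonneg q_le1 q_bounded] by simp
  also have "\<dots> = ennreal (exp (- (lam * enn2real (?c p))))"
  proof (rule INF_eq_limit)
    have c_le: "?c (q k) \<le> ?c p" for k
      using q_le by (intro nn_integral_mono ennreal_leI) auto
    have "enn2real (?c (q k)) \<le> enn2real (?c (q (Suc k)))" for k
      using c_le[of "Suc k"] fin q_mono
      by (intro enn2real_mono nn_integral_mono ennreal_leI) (auto simp: order_le_less_trans)
    then show "decseq (\<lambda>k. ennreal (exp (- (lam * enn2real (?c (q k))))))"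
      using \<open>0 \<le> lam\<close> by (intro decseq_SucI ennreal_leI) (auto intro: mult_left_mono)
    have "(\<lambda>k. ?c (q k)) \<longlonglongrightarrow> ?c p"
      using fin q_le q_lim
      by (intro nn_integral_dominated_convergence[where w="\<lambda>x. ennreal (p x)"])
        (auto intro!: ennreal_leI tendsto_ennrealI)
    then show "(\<lambda>k. ennreal (exp (- (lam * enn2real (?c (q k)))))) \<longlonglongrightarrow> ennreal (exp (- (lam * enn2real (?c p))))"
      using fin by (intro tendsto_ennrealI tendsto_exp tendsto_minus tendsto_mult tendsto_const tendsto_enn2real) auto
  qed
  finally show ?thesis .
qed

section \<open>Integration over product measures\<close>

text \<open>The integrand sees only the coordinates in \<open>J\<close>; restriction to them maps
  the infinite product to the finite one, where the integral factorizes.\<close>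

lemma nn_integral_PiM_prod:
  assumes "\<And>i. prob_space (N i)" "finite J" "\<And>i. i \<in> J \<Longrightarrow> f i \<in> borel_measurable (N i)"
  shows "(\<integral>\<^sup>+\<omega>. (\<Prod>i\<in>J. f i (\<omega> i)) \<partial>Pi\<^sub>M UNIV N) = (\<Prod>i\<in>J. \<integral>\<^sup>+x. f i x \<partial>N i)"
proof -
  interpret product_prob_space N UNIV
    using assms(1) by (intro product_prob_spaceI)
  have "(\<Prod>i\<in>J. \<integral>\<^sup>+x. f i x \<partial>N i) = (\<integral>\<^sup>+\<omega>. (\<Prod>i\<in>J. f i (\<omega> i)) \<partial>Pi\<^sub>M J N)"
    using assms(2,3) by (simp add: product_nn_integral_prod)
  also have "\<dots> = (\<integral>\<^sup>+\<omega>. (\<Prod>i\<in>J. f i (\<omega> i)) \<partial>distr (Pi\<^sub>M UNIV N) (Pi\<^sub>M J N) (\<lambda>x. restrict x J))"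
    using assms(2) by (simp add: distr_PiM_restrict_finite)
  also have "\<dots> = (\<integral>\<^sup>+\<omega>. (\<Prod>i\<in>J. f i (restrict \<omega> J i)) \<partial>Pi\<^sub>M UNIV N)"
    using assms(3) by (intro nn_integral_distr measurable_restrict_subset borel_measurable_prod_ennreal)
      (auto intro: measurable_compose[OF measurable_component_singleton])
  finally show ?thesis by simp
qed

text \<open>Tonelli, applied until the last component is outermost. That component will be the
  receiver's boresight, which all devices share and which has to be fixed before they can be treated
  as independently thinned.\<close>

lemma nn_integral_pair5_last_first:
  assumes "sigma_finite_measure A" "sigma_finite_measure B" "sigma_finite_measure C"
    "sigma_finite_measure D" "sigma_finite_measure E"
    and [measurable]: "f \<in> borel_measurable (A \<Otimes>\<^sub>M B \<Otimes>\<^sub>M C \<Otimes>\<^sub>M D \<Otimes>\<^sub>M E)"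
  shows "(\<integral>\<^sup>+u. f u \<partial>(A \<Otimes>\<^sub>M B \<Otimes>\<^sub>M C \<Otimes>\<^sub>M D \<Otimes>\<^sub>M E)) =
    (\<integral>\<^sup>+t. \<integral>\<^sup>+a. \<integral>\<^sup>+b. \<integral>\<^sup>+c. \<integral>\<^sup>+d. f (a, b, c, d, t) \<partial>D \<partial>C \<partial>B \<partial>A \<partial>E)"
proof -
  interpret A: sigma_finite_measure A by fact
  interpret B: sigma_finite_measure B by fact
  interpret C: sigma_finite_measure C by fact
  interpret D: sigma_finite_measure D by fact
  interpret E: sigma_finite_measure E by fact
  interpret AE: pair_sigma_finite A E ..
  interpret BE: pair_sigma_finite B E ..
  interpret CE: pair_sigma_finite C E ..
  interpret DE: pair_sigma_finite D E ..
  interpret CDE: pair_sigma_finite C "D \<Otimes>\<^sub>M E" ..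
  interpret BCDE: pair_sigma_finite B "C \<Otimes>\<^sub>M D \<Otimes>\<^sub>M E" ..
  have "(\<integral>\<^sup>+u. f u \<partial>(A \<Otimes>\<^sub>M B \<Otimes>\<^sub>M C \<Otimes>\<^sub>M D \<Otimes>\<^sub>M E)) =
      (\<integral>\<^sup>+a. \<integral>\<^sup>+u. f (a, u) \<partial>(B \<Otimes>\<^sub>M C \<Otimes>\<^sub>M D \<Otimes>\<^sub>M E) \<partial>A)"
    by (intro BCDE.nn_integral_fst[symmetric]) measurable
  also have "\<dots> = (\<integral>\<^sup>+a. \<integral>\<^sup>+b. \<integral>\<^sup>+u. f (a, b, u) \<partial>(C \<Otimes>\<^sub>M D \<Otimes>\<^sub>M E) \<partial>B \<partial>A)"
    by (intro nn_integral_cong CDE.nn_integral_fst[symmetric]) measurable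
  also have "\<dots> = (\<integral>\<^sup>+a. \<integral>\<^sup>+b. \<integral>\<^sup>+c. \<integral>\<^sup>+u. f (a, b, c, u) \<partial>(D \<Otimes>\<^sub>M E) \<partial>C \<partial>B \<partial>A)"
    by (intro nn_integral_cong DE.nn_integral_fst[symmetric]) measurable
  also have "\<dots> = (\<integral>\<^sup>+a. \<integral>\<^sup>+b. \<integral>\<^sup>+c. \<integral>\<^sup>+t. \<integral>\<^sup>+d. f (a, b, c, d, t) \<partial>D \<partial>E \<partial>C \<partial>B \<partial>A)"
    by (intro nn_integral_cong DE.nn_integral_snd[symmetric]) measurable
  also have "\<dots> = (\<integral>\<^sup>+a. \<integral>\<^sup>+b. \<integral>\<^sup>+t. \<integral>\<^sup>+c. \<integral>\<^sup>+d. f (a, b, c, d, t) \<partial>D \<partial>C \<partial>E \<partial>B \<partial>A)"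
    by (intro nn_integral_cong CE.Fubini'[symmetric]) measurable
  also have "\<dots> = (\<integral>\<^sup>+a. \<integral>\<^sup>+t. \<integral>\<^sup>+b. \<integral>\<^sup>+c. \<integral>\<^sup>+d. f (a, b, c, d, t) \<partial>D \<partial>C \<partial>B \<partial>E \<partial>A)"
    by (intro nn_integral_cong BE.Fubini'[symmetric]) measurable
  also have "\<dots> = (\<integral>\<^sup>+t. \<integral>\<^sup>+a. \<integral>\<^sup>+b. \<integral>\<^sup>+c. \<integral>\<^sup>+d. f (a, b, c, d, t) \<partial>D \<partial>C \<partial>B \<partial>A \<partial>E)"
    by (intro AE.Fubini'[symmetric]) measurable
  finally show ?thesis .
qed

text \<open>Integrating out one mark trades its indicator for its probability. It serves in turn for
  the fading, the boresight and the slot of a device; \<open>c \<le> 1\<close> keeps the integrand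
  nonnegative, so that \<open>ennreal\<close> does not truncate.\<close>

lemma nn_integral_one_minus_indicator:
  assumes "prob_space N" and [measurable]: "A \<in> sets N" and "0 \<le> c" "c \<le> 1"
  shows "(\<integral>\<^sup>+x. ennreal (1 - c * indicator A x) \<partial>N) = ennreal (1 - c * measure N A)"
proof -
  interpret prob_space N by fact
  have "integrable N (indicator A :: _ \<Rightarrow> real)"
    by (rule integrable_const_bound[where B=1]) auto
  then have int: "integrable N (\<lambda>x. c * indicator A x)" by simp
  have "(\<integral>\<^sup>+x. ennreal (1 - c * indicator A x) \<partial>N) = ennreal (\<integral>x. 1 - c * indicator A x \<partial>N)"
    using assms(3,4) int
    by (intro nn_integral_eq_integral Bochner_Integration.integrable_diff AE_I2) (auto split: split_indicator)
  also have "(\<integral>x. 1 - c * indicator A x \<partial>N) = 1 - c * measure N A"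
    using int by (subst Bochner_Integration.integral_diff) (auto simp: prob_space)
  finally show ?thesis .
qed

section \<open>Laws of the marks\<close>

lemma sets_fading_law [simp, measurable_cong]: "sets (fading_law fad) = sets borel"
  by (cases fad) auto

lemma space_fading_law [simp]: "space (fading_law fad) = UNIV"
  by (cases fad) auto

lemma prob_space_fading_law: "prob_space (fading_law fad)"
  by (cases fad) (auto intro: prob_space_return prob_space_exponential_density)

lemma sets_boresight_law [simp, measurable_cong]: "sets boresight_law = sets borel"
  by (simp add: boresight_law_def)

lemma space_boresight_law [simp]: "space boresight_law = UNIV"
  by (simp add: boresight_law_def)

lemma prob_space_boresight_law: "prob_space boresight_law"
  unfolding boresight_law_def by (rule prob_space_uniform_measure) auto

lemma fading_const_pos: "0 < \<alpha> \<Longrightarrow> 0 < fading_const \<alpha> fad"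
  by (cases fad) (auto intro!: Gamma_real_pos add_pos_pos)

text \<open>For Rayleigh fading this is Euler's integral for \<open>Gamma\<close>. The
  \<open>max\<close> with 0 makes the integrand vanish for \<open>z \<le> 0\<close>, where no device
  can exceed a positive threshold.\<close>

lemma nn_integral_fading_moment:
  assumes "0 < \<alpha>"
  shows "(\<integral>\<^sup>+z. ennreal (max 0 z powr (2 / \<alpha>)) \<partial>fading_law fad) = ennreal (fading_const \<alpha> fad)"
proof (cases fad)
  case No_Fading
  then show ?thesis by (simp add: nn_integral_return)
next
  case Rayleigh
  have "(\<integral>\<^sup>+z. ennreal (max 0 z powr (2 / \<alpha>)) \<partial>fading_law fad) =
      (\<integral>\<^sup>+z. ennreal (exponential_density 1 z) * ennreal (max 0 z powr (2 / \<alpha>)) \<partial>lborel)"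
    using Rayleigh by (simp add: nn_integral_density)
  \<comment> \<open>The exponent is written as the argument of \<open>Gamma\<close> minus 1, to
    match Euler's integral.\<close>
  also have "\<dots> = (\<integral>\<^sup>+z. ennreal (z powr (1 + 2 / \<alpha> - 1) / exp z) * indicator {0..} z \<partial>lborel)"
    by (intro nn_integral_cong)
      (auto simp: exponential_density_def exp_minus field_simps simp flip: ennreal_mult split: split_indicator)
  also have "\<dots> = ennreal (Gamma (1 + 2 / \<alpha>))"
    using assms by (intro nn_integral_has_integral_lebesgue' Gamma_integral_real) (auto simp: add_pos_pos)
  finally show ?thesis using Rayleigh by simp
qed

text \<open>Independent thinning in integral form. \<open>joint_law\<close> turns the expectation
  into an iterated integral; given the receiver's boresight and the positions, the marks of
  different devices are independent, so the product over devices can be integrated factor by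
  factor.\<close>

lemma (in radar_network) nn_integral_marks:
  fixes g :: "real^2 \<Rightarrow> nat \<Rightarrow> real \<Rightarrow> real \<Rightarrow> real \<Rightarrow> ennreal"
  assumes g: "(\<lambda>(x, m, b, z, t). g x m b z t) \<in>
    borel_measurable (borel \<Otimes>\<^sub>M count_space UNIV \<Otimes>\<^sub>M borel \<Otimes>\<^sub>M borel \<Otimes>\<^sub>M borel)"
  shows "(\<integral>\<^sup>+w. (\<Prod>i<n. g (X i w) (mark i w) (bs i w) (fade i w) (bs0 w)) \<partial>P) =
    (\<integral>\<^sup>+t. \<integral>\<^sup>+w. (\<Prod>i<n. \<integral>\<^sup>+m. \<integral>\<^sup>+b. \<integral>\<^sup>+z. g (X i w) m b z t
       \<partial>fading_law fad \<partial>boresight_law \<partial>measure_pmf (pmf_of_set {..<M})) \<partial>P \<partial>boresight_law)"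
proof -
  have [measurable]: "(\<lambda>w. g (f1 w) (f2 w) (f3 w) (f4 w) (f5 w)) \<in> borel_measurable N"
    if "f1 \<in> borel_measurable N" "f2 \<in> measurable N (count_space UNIV)" "f3 \<in> borel_measurable N"
      "f4 \<in> borel_measurable N" "f5 \<in> borel_measurable N" for N :: "'q measure" and f1 f2 f3 f4 f5
    using measurable_compose[OF _ g, of "\<lambda>w. (f1 w, f2 w, f3 w, f4 w, f5 w)" N] that by simp
  have [measurable]: "X i \<in> borel_measurable P" for i
    using ppp by (rule homogeneous_ppp_measurable)
  note [measurable] = mark_measurable bs_measurable fade_measurable bs0_measurable
  let ?X = "distr P (\<Pi>\<^sub>M i\<in>UNIV. borel) (\<lambda>w i. X i w)"
  let ?m = "\<Pi>\<^sub>M i\<in>UNIV. measure_pmf (pmf_of_set {..<M})"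
  let ?b = "\<Pi>\<^sub>M i\<in>UNIV. boresight_law"
  let ?z = "\<Pi>\<^sub>M i\<in>UNIV. fading_law fad"
  let ?S = "(\<Pi>\<^sub>M i\<in>UNIV. borel) \<Otimes>\<^sub>M (\<Pi>\<^sub>M i\<in>UNIV. count_space UNIV) \<Otimes>\<^sub>M
          (\<Pi>\<^sub>M i\<in>UNIV. borel) \<Otimes>\<^sub>M (\<Pi>\<^sub>M i\<in>UNIV. borel) \<Otimes>\<^sub>M borel"
  have [measurable_cong]: "sets ?m = sets (\<Pi>\<^sub>M i\<in>UNIV. count_space UNIV)"
    "sets ?b = sets (\<Pi>\<^sub>M i\<in>UNIV. borel)" "sets ?z = sets (\<Pi>\<^sub>M i\<in>UNIV. borel)"
    by (auto intro!: sets_PiM_cong)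
  let ?f = "\<lambda>(x, m, b, z, t). \<Prod>i<n. g (x i) (m i) (b i) (z i) t"
  have f: "?f \<in> borel_measurable ?S" by measurable
  have f': "?f \<in> borel_measurable (?X \<Otimes>\<^sub>M ?m \<Otimes>\<^sub>M ?b \<Otimes>\<^sub>M ?z \<Otimes>\<^sub>M boresight_law)" by measurable
  have sf: "sigma_finite_measure N" if "prob_space N" for N :: "'q measure"
    using that by (simp add: prob_space_imp_sigma_finite)
  have pm: "prob_space ?m" by (intro prob_space_PiM prob_space_measure_pmf)
  have pb: "prob_space ?b" by (intro prob_space_PiM prob_space_boresight_law)
  have pz: "prob_space ?z" by (intro prob_space_PiM prob_space_fading_law)
  have [measurable]: "(\<lambda>w i. X i w) \<in> measurable P (\<Pi>\<^sub>M i\<in>UNIV. borel)"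
    "(\<lambda>w i. mark i w) \<in> measurable P (\<Pi>\<^sub>M i\<in>UNIV. count_space UNIV)"
    "(\<lambda>w i. bs i w) \<in> measurable P (\<Pi>\<^sub>M i\<in>UNIV. borel)"
    "(\<lambda>w i. fade i w) \<in> measurable P (\<Pi>\<^sub>M i\<in>UNIV. borel)"
    by (auto intro!: measurable_PiM_single')
  have px: "prob_space ?X" by (intro prob_space_distr) measurable
  interpret zl: prob_space "fading_law fad" by (rule prob_space_fading_law)
  interpret bl: prob_space boresight_law by (rule prob_space_boresight_law)
  have "(\<integral>\<^sup>+w. (\<Prod>i<n. g (X i w) (mark i w) (bs i w) (fade i w) (bs0 w)) \<partial>P) =
      (\<integral>\<^sup>+u. ?f u \<partial>distr P ?S (\<lambda>w. (\<lambda>i. X i w, \<lambda>i. mark i w, \<lambda>i. bs i w, \<lambda>i. fade i w, bs0 w)))"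
    using f by (subst nn_integral_distr) auto
  also have "\<dots> = (\<integral>\<^sup>+t. \<integral>\<^sup>+x. \<integral>\<^sup>+m. \<integral>\<^sup>+b. \<integral>\<^sup>+z. (\<Prod>i<n. g (x i) (m i) (b i) (z i) t)
      \<partial>?z \<partial>?b \<partial>?m \<partial>?X \<partial>boresight_law)"
    unfolding joint_law
    by (subst nn_integral_pair5_last_first[OF sf sf sf sf sf f'])
      (auto intro: pm pb pz px prob_space_boresight_law)
  also have "\<dots> = (\<integral>\<^sup>+t. \<integral>\<^sup>+x. (\<Prod>i<n. \<integral>\<^sup>+m. \<integral>\<^sup>+b. \<integral>\<^sup>+z. g (x i) m b z t
       \<partial>fading_law fad \<partial>boresight_law \<partial>measure_pmf (pmf_of_set {..<M})) \<partial>?X \<partial>boresight_law)"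
  \<comment> \<open>Innermost integral first: after each integration the result is again a product
    over devices, so the factorization applies to the next mark sequence.\<close>
  proof (intro nn_integral_cong)
    fix t x
    have "(\<integral>\<^sup>+m. \<integral>\<^sup>+b. \<integral>\<^sup>+z. (\<Prod>i<n. g (x i) (m i) (b i) (z i) t) \<partial>?z \<partial>?b \<partial>?m) =
        (\<integral>\<^sup>+m. \<integral>\<^sup>+b. (\<Prod>i<n. \<integral>\<^sup>+z. g (x i) (m i) (b i) z t \<partial>fading_law fad) \<partial>?b \<partial>?m)"
      by (intro nn_integral_cong nn_integral_PiM_prod prob_space_fading_law) auto
    also have "\<dots> = (\<integral>\<^sup>+m. (\<Prod>i<n. \<integral>\<^sup>+b. \<integral>\<^sup>+z. g (x i) (m i) b z t \<partial>fading_law fad \<partial>boresight_law) \<partial>?m)"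
      by (intro nn_integral_cong nn_integral_PiM_prod prob_space_boresight_law) measurable
    also have "\<dots> = (\<Prod>i<n. \<integral>\<^sup>+m. \<integral>\<^sup>+b. \<integral>\<^sup>+z. g (x i) m b z t
       \<partial>fading_law fad \<partial>boresight_law \<partial>measure_pmf (pmf_of_set {..<M}))"
      by (intro nn_integral_PiM_prod prob_space_measure_pmf) auto
    finally show "(\<integral>\<^sup>+m. \<integral>\<^sup>+b. \<integral>\<^sup>+z. (\<Prod>i<n. g (x i) (m i) (b i) (z i) t) \<partial>?z \<partial>?b \<partial>?m) =
        (\<Prod>i<n. \<integral>\<^sup>+m. \<integral>\<^sup>+b. \<integral>\<^sup>+z. g (x i) m b z t
       \<partial>fading_law fad \<partial>boresight_law \<partial>measure_pmf (pmf_of_set {..<M}))" .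
  qed
  also have "\<dots> = (\<integral>\<^sup>+t. \<integral>\<^sup>+w. (\<Prod>i<n. \<integral>\<^sup>+m. \<integral>\<^sup>+b. \<integral>\<^sup>+z. g (X i w) m b z t
       \<partial>fading_law fad \<partial>boresight_law \<partial>measure_pmf (pmf_of_set {..<M})) \<partial>P \<partial>boresight_law)"
    by (intro nn_integral_cong, subst nn_integral_distr) measurable
  finally show ?thesis .
qed

section \<open>One device: slot, boresight and audible area\<close>

lemma transmits_in_iff: "m < M \<Longrightarrow> transmits_in M m s \<longleftrightarrow> m = s mod M"
  unfolding transmits_in_def by (metis mod_div_mult_eq mod_less mod_mult_self1)

lemma measure_transmits_in:
  assumes "0 < M"
  shows "measure (measure_pmf (pmf_of_set {..<M})) {m. transmits_in M m s} = 1 / real M"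
proof -
  have "{..<M} \<inter> {m. transmits_in M m s} = {s mod M}"
    using assms transmits_in_iff[of _ M s] by auto
  then show ?thesis
    using assms by (subst measure_pmf_of_set) auto
qed

lemma measure_boresight_law_sector:
  assumes \<phi>: "0 < \<phi>" "\<phi> \<le> 2 * pi" and "x \<noteq> 0"
  shows "measure boresight_law {b. x \<in> sector \<phi> b} = \<phi> / (2 * pi)"
proof -
  have [measurable]: "{b. x \<in> sector \<phi> b} \<in> sets borel" using \<phi> by measurable
  show ?thesis
    using emeasure_visible_angles[OF assms] \<phi>
    by (simp add: boresight_law_def measure_uniform_measure measure_def divide_ennreal)
qed

text \<open>A positive threshold can only be exceeded if neither gain vanishes, and then both gains
  equal \<open>Gm\<close>.\<close>

lemma received_power_gt_iff:
  assumes "0 < \<Theta>"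
  shows "\<Theta> < received_power Pt Gm l \<alpha> \<phi> t x b z \<longleftrightarrow>
    x \<in> sector \<phi> t \<and> - x \<in> sector \<phi> b \<and> \<Theta> < Pt * Gm\<^sup>2 * l * z * norm x powr - \<alpha>"
  using assms by (auto simp: received_power_def cone_gain_def power2_eq_square mult_ac)

text \<open>
  Integrating out the fading coefficient last leaves, for each of its values \<open>z\<close>, the area of the
  sector of radius \<open>(a z / \<Theta>) powr (1 / \<alpha>)\<close>.
\<close>
lemma nn_integral_audible_sector:
  assumes \<phi>: "0 < \<phi>" "\<phi> \<le> 2 * pi" and pos: "0 < \<alpha>" "0 < a" "0 < \<Theta>"
  shows "(\<integral>\<^sup>+x. indicator (sector \<phi> t) x *
      emeasure (fading_law fad) {z. \<Theta> < a * z * norm x powr - \<alpha>} \<partial>lborel) =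
    ennreal (\<phi> / 2 * (a / \<Theta>) powr (2 / \<alpha>) * fading_const \<alpha> fad)"
proof -
  interpret zl: prob_space "fading_law fad" by (rule prob_space_fading_law)
  interpret pair_sigma_finite "lborel :: (real^2) measure" "fading_law fad" ..
  let ?h = "\<lambda>x z. (if x \<in> sector \<phi> t \<and> \<Theta> < a * z * norm x powr - \<alpha> then 1 else 0 :: ennreal)"
  have [measurable]: "{z. \<Theta> < a * z * norm x powr - \<alpha>} \<in> sets borel" for x :: "real^2"
    by measurable
  have "(\<integral>\<^sup>+x. indicator (sector \<phi> t) x *
      emeasure (fading_law fad) {z. \<Theta> < a * z * norm x powr - \<alpha>} \<partial>lborel) =
      (\<integral>\<^sup>+x. \<integral>\<^sup>+z. ?h x z \<partial>fading_law fad \<partial>lborel)"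
  proof (intro nn_integral_cong)
    fix x :: "real^2"
    have "(\<integral>\<^sup>+z. ?h x z \<partial>fading_law fad) =
        (\<integral>\<^sup>+z. indicator (sector \<phi> t) x * indicator {z. \<Theta> < a * z * norm x powr - \<alpha>} z \<partial>fading_law fad)"
      by (intro nn_integral_cong) (auto split: split_indicator)
    then show "indicator (sector \<phi> t) x * emeasure (fading_law fad) {z. \<Theta> < a * z * norm x powr - \<alpha>} =
        (\<integral>\<^sup>+z. ?h x z \<partial>fading_law fad)"
      by (simp add: nn_integral_cmult_indicator)
  qed
  also have "\<dots> = (\<integral>\<^sup>+z. \<integral>\<^sup>+x. ?h x z \<partial>lborel \<partial>fading_law fad)"
    using \<phi> by (intro Fubini'[symmetric]) measurable
  also have "\<dots> = (\<integral>\<^sup>+z. ennreal (\<phi> / 2 * (a / \<Theta>) powr (2 / \<alpha>)) * ennreal (max 0 z powr (2 / \<alpha>)) \<partial>fading_law fad)"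
  proof (intro nn_integral_cong)
    fix z :: real
    show "(\<integral>\<^sup>+x. ?h x z \<partial>lborel) = ennreal (\<phi> / 2 * (a / \<Theta>) powr (2 / \<alpha>)) * ennreal (max 0 z powr (2 / \<alpha>))"
    proof (cases "z > 0")
      case False
      then have "a * z \<le> 0" using pos by (simp add: mult_nonneg_nonpos)
      then have le: "a * z * norm x powr - \<alpha> \<le> 0" for x :: "real^2"
        by (rule mult_nonpos_nonneg) simp
      have "?h x z = 0" for x
        using pos le[of x] by auto
      then show ?thesis using False by (simp add: max_absorb1)
    next
      case z: True
      define r where "r = (a * z / \<Theta>) powr (1 / \<alpha>)"
      have r: "0 < r" using pos z by (simp add: r_def)
      \<comment> \<open>The origin is excepted because \<open>0 powr - \<alpha> = 0\<close> makes a
        device there inaudible although it lies in the ball.\<close>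
      have r_iff: "\<Theta> < a * z * norm x powr - \<alpha> \<longleftrightarrow> norm x < r" if "x \<noteq> 0" for x :: "real^2"
      proof -
        have "\<Theta> < a * z * norm x powr - \<alpha> \<longleftrightarrow> norm x powr \<alpha> < a * z / \<Theta>"
          using pos that by (simp add: powr_minus field_simps)
        also have "a * z / \<Theta> = r powr \<alpha>"
          using pos z by (simp add: r_def powr_powr)
        also have "norm x powr \<alpha> < r powr \<alpha> \<longleftrightarrow> norm x < r"
          using pos(1) r by (metis less_imp_le norm_ge_zero not_less powr_less_mono2 powr_mono2)
        finally show ?thesis .
      qed
      have [measurable]: "sector \<phi> t \<in> sets borel"
        using \<phi> by (rule sets_sector)
      have "(\<integral>\<^sup>+x. ?h x z \<partial>lborel) = (\<integral>\<^sup>+x. indicator (sector \<phi> t \<inter> ball 0 r) x \<partial>lborel)"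
      proof (rule nn_integral_cong_AE)
        have "AE x in lborel. x \<noteq> (0 :: real^2)"
          by (rule AE_lborel_singleton)
        then show "AE x in lborel. ?h x z = indicator (sector \<phi> t \<inter> ball 0 r) x"
          by eventually_elim (auto simp: r_iff split: split_indicator)
      qed
      also have "\<dots> = ennreal (\<phi> / 2 * r\<^sup>2)"
        using emeasure_sector_Int_ball[OF \<phi>, of r t] r by simp
      also have "r\<^sup>2 = (a / \<Theta>) powr (2 / \<alpha>) * z powr (2 / \<alpha>)"
        using pos z by (simp add: r_def powr_powr powr_mult powr_divide flip: powr_numeral)
      finally show ?thesis using z \<phi> by (simp add: max_absorb2 mult_ac flip: ennreal_mult)
    qed
  qed
  also have "\<dots> = ennreal (\<phi> / 2 * (a / \<Theta>) powr (2 / \<alpha>) * fading_const \<alpha> fad)"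
    using pos \<phi> by (subst nn_integral_cmult)
      (auto simp: nn_integral_fading_moment simp flip: ennreal_mult')
  finally show ?thesis .
qed

section \<open>The distribution of the strongest interference\<close>

context radar_network
begin

text \<open>Makes the event a countable intersection over devices. In \<open>ereal\<close> this also
  covers slots without active devices, where the supremum is \<open>-\<infinity>\<close>.\<close>

lemma strongest_interference_le_iff:
  "strongest_interference Pt Gm l \<alpha> \<phi> s w \<le> ereal \<Theta> \<longleftrightarrow>
    (\<forall>i. \<not> (transmits_in M (mark i w) s \<and>
      \<Theta> < received_power Pt Gm l \<alpha> \<phi> (bs0 w) (X i w) (bs i w) (fade i w)))"
  by (auto simp: strongest_interference_def active_def SUP_le_iff not_less)

text \<open>The void probability of the process of devices above the threshold; for
  \<open>lam > 0\<close> it is a Frechet law in \<Theta> with shape \<open>2 / \<alpha>\<close>.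
  Every slot \<open>s\<close> selects exactly one mark, of probability \<open>1 / M\<close>, so
  \<open>s\<close> does not occur in the result.\<close>

lemma strongest_interference_cdf_eq:
  assumes lam: "0 \<le> lam" and "0 < M" and \<phi>: "0 < \<phi>" "\<phi> \<le> 2 * pi" and "0 < \<alpha>"
    and a: "a = Pt * Gm\<^sup>2 * l" "0 < a" and \<Theta>: "0 < \<Theta>"
  shows "strongest_interference_cdf Pt Gm l \<alpha> \<phi> s \<Theta> =
    exp (- (lam * \<phi>\<^sup>2 * fading_const \<alpha> fad / (4 * pi * real M) * (a / \<Theta>) powr (2 / \<alpha>)))"
proof -
  have [measurable]: "X i \<in> borel_measurable P" for i
    using ppp by (rule homogeneous_ppp_measurable)
  note [measurable] = mark_measurable bs_measurable fade_measurable bs0_measurable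
  interpret zl: prob_space "fading_law fad" by (rule prob_space_fading_law)
  interpret bl: prob_space boresight_law by (rule prob_space_boresight_law)
  define audible where "audible x z \<longleftrightarrow> \<Theta> < a * z * norm x powr - \<alpha>" for x :: "real^2" and z
  define hit where "hit x m b z t \<longleftrightarrow>
    transmits_in M m s \<and> x \<in> sector \<phi> t \<and> - x \<in> sector \<phi> b \<and> audible x z" for x m b z t
  define g where "g x m b z t = (if hit x m b z t then 0 else 1 :: ennreal)" for x m b z t
  define T where "T x = measure (fading_law fad) {z. audible x z}" for x
  \<comment> \<open>The thinning probability: the chance that a device at \<open>x\<close> exceeds
    the threshold when the receiver's boresight is \<open>t\<close>.\<close>
  define p where "p t x = 1 / real M * (\<phi> / (2 * pi)) * indicator (sector \<phi> t) x * T x" for t x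
  have [measurable]: "Measurable.pred N (\<lambda>w. audible (f w) (h w))"
    if [measurable]: "f \<in> borel_measurable N" "h \<in> borel_measurable N" for N :: "'q measure" and f h
    unfolding audible_def by measurable
  have [measurable]: "Measurable.pred N (\<lambda>w. hit (f1 w) (f2 w) (f3 w) (f4 w) (f5 w))"
    if [measurable]: "f1 \<in> borel_measurable N" "f2 \<in> measurable N (count_space UNIV)" "f3 \<in> borel_measurable N"
      "f4 \<in> borel_measurable N" "f5 \<in> borel_measurable N" for N :: "'q measure" and f1 f2 f3 f4 f5
    using \<phi> unfolding hit_def by measurable
  have T01: "0 \<le> T x" "T x \<le> 1" for x by (auto simp: T_def)
  have T0: "T 0 = 0" using \<Theta> by (simp add: T_def audible_def)
  have \<phi>01: "0 \<le> \<phi> / (2 * pi)" "\<phi> / (2 * pi) \<le> 1" using \<phi> by auto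
  have M01: "0 \<le> 1 / real M" "1 / real M \<le> 1" using \<open>0 < M\<close> by auto
  have [measurable]: "T \<in> borel_measurable borel"
    unfolding T_def by measurable
  have [measurable]: "sector \<phi> t \<in> sets borel" for t
    using \<phi> by (rule sets_sector)
  have p01: "0 \<le> p t x" "p t x \<le> 1" for t x
    unfolding p_def by (intro mult_le_one mult_nonneg_nonneg T01 \<phi>01 M01 indicator_pos_le indicator_le_1)+
  have [measurable]: "p t \<in> borel_measurable borel" for t
    unfolding p_def by measurable

  have thinning: "(\<integral>\<^sup>+m. \<integral>\<^sup>+b. \<integral>\<^sup>+z. g x m b z t \<partial>fading_law fad \<partial>boresight_law
      \<partial>measure_pmf (pmf_of_set {..<M})) = ennreal (1 - p t x)" for x t
  proof -
    have z: "(\<integral>\<^sup>+z. g x m b z t \<partial>fading_law fad) =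
        ennreal (1 - (of_bool (transmits_in M m s \<and> x \<in> sector \<phi> t) * T x) * indicator {b. - x \<in> sector \<phi> b} b)"
      (is "_ = ennreal (1 - ?c m * _)") for m b
    proof -
      have "(\<integral>\<^sup>+z. g x m b z t \<partial>fading_law fad) = (\<integral>\<^sup>+z. ennreal (1 -
          of_bool (transmits_in M m s \<and> x \<in> sector \<phi> t \<and> - x \<in> sector \<phi> b) * indicator {z. audible x z} z) \<partial>fading_law fad)"
        by (intro nn_integral_cong) (auto simp: g_def hit_def)
      also have "\<dots> = ennreal (1 - of_bool (transmits_in M m s \<and> x \<in> sector \<phi> t \<and> - x \<in> sector \<phi> b) * T x)"
        unfolding T_def by (intro nn_integral_one_minus_indicator prob_space_fading_law) auto
      finally show ?thesis by (auto split: split_indicator)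
    qed
    have b: "(\<integral>\<^sup>+b. \<integral>\<^sup>+z. g x m b z t \<partial>fading_law fad \<partial>boresight_law) =
        ennreal (1 - (\<phi> / (2 * pi) * indicator (sector \<phi> t) x * T x) * indicator {m. transmits_in M m s} m)" for m
    proof (cases "x = 0")
      case True
      then show ?thesis unfolding z by (simp add: T0 bl.emeasure_space_1[simplified])
    next
      case False
      have [measurable]: "{b. - x \<in> sector \<phi> b} \<in> sets borel" using \<phi> by measurable
      have "(\<integral>\<^sup>+b. \<integral>\<^sup>+z. g x m b z t \<partial>fading_law fad \<partial>boresight_law) =
          ennreal (1 - ?c m * measure boresight_law {b. - x \<in> sector \<phi> b})"
        unfolding z using T01[of x]
        by (intro nn_integral_one_minus_indicator prob_space_boresight_law) auto
      then show ?thesis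
        using False measure_boresight_law_sector[OF \<phi>, of "- x"]
        by (auto simp: mult_ac split: split_indicator)
    qed
    have "0 \<le> \<phi> / (2 * pi) * indicator (sector \<phi> t) x * T x"
      "\<phi> / (2 * pi) * indicator (sector \<phi> t) x * T x \<le> 1"
      by (intro mult_le_one mult_nonneg_nonneg T01 \<phi>01 indicator_pos_le indicator_le_1)+
    then show ?thesis
      unfolding b
      by (subst nn_integral_one_minus_indicator[OF prob_space_measure_pmf])
        (simp_all add: measure_transmits_in[OF \<open>0 < M\<close>] p_def mult_ac)
  qed

  \<comment> \<open>The intensity is kept apart here: \<open>lam * \<Lambda>\<close> is the expected
    number of devices above the threshold. The denominator collects \<open>1 / M\<close>,
    \<open>\<phi> / (2 * pi)\<close> and the factor \<open>\<phi> / 2\<close> of the sector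
    area.\<close>
  define \<Lambda> where "\<Lambda> = \<phi>\<^sup>2 * fading_const \<alpha> fad / (4 * pi * real M) * (a / \<Theta>) powr (2 / \<alpha>)"
  have "0 \<le> \<Lambda>"
    using fading_const_pos[OF \<open>0 < \<alpha>\<close>, of fad] by (simp add: \<Lambda>_def)
  have p_integral: "(\<integral>\<^sup>+x. ennreal (p t x) \<partial>lborel) = ennreal \<Lambda>" for t
  proof -
    have "(\<integral>\<^sup>+x. ennreal (p t x) \<partial>lborel) = (\<integral>\<^sup>+x. ennreal (1 / real M * (\<phi> / (2 * pi))) *
        (indicator (sector \<phi> t) x * emeasure (fading_law fad) {z. audible x z}) \<partial>lborel)"
      using \<phi>
      by (intro nn_integral_cong)
        (auto simp: p_def T_def zl.emeasure_eq_measure simp flip: ennreal_mult split: split_indicator)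
    also have "\<dots> = ennreal (1 / real M * (\<phi> / (2 * pi))) *
        ennreal (\<phi> / 2 * (a / \<Theta>) powr (2 / \<alpha>) * fading_const \<alpha> fad)"
      by (subst nn_integral_cmult)
        (simp_all add: nn_integral_audible_sector[OF \<phi> \<open>0 < \<alpha>\<close> \<open>0 < a\<close> \<Theta>, folded audible_def])
    also have "\<dots> = ennreal (1 / real M * (\<phi> / (2 * pi)) * (\<phi> / 2 * (a / \<Theta>) powr (2 / \<alpha>) * fading_const \<alpha> fad))"
      using \<phi> by (intro ennreal_mult'[symmetric]) auto
    finally show ?thesis by (simp add: \<Lambda>_def power2_eq_square field_simps)
  qed

  have g_measurable: "(\<lambda>(x, m, b, z, t). g x m b z t) \<in>
      borel_measurable (borel \<Otimes>\<^sub>M count_space UNIV \<Otimes>\<^sub>M borel \<Otimes>\<^sub>M borel \<Otimes>\<^sub>M borel)"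
    unfolding g_def by measurable
  have fin_hit: "emeasure P {w \<in> space P. \<forall>i<n. \<not> hit (X i w) (mark i w) (bs i w) (fade i w) (bs0 w)} =
      (\<integral>\<^sup>+t. \<integral>\<^sup>+w. (\<Prod>i<n. ennreal (1 - p t (X i w))) \<partial>P \<partial>boresight_law)" for n
  proof -
    have "emeasure P {w \<in> space P. \<forall>i<n. \<not> hit (X i w) (mark i w) (bs i w) (fade i w) (bs0 w)} =
        (\<integral>\<^sup>+w. indicator {w \<in> space P. \<forall>i<n. \<not> hit (X i w) (mark i w) (bs i w) (fade i w) (bs0 w)} w \<partial>P)"
      by (intro nn_integral_indicator[symmetric]) measurable
    also have "\<dots> = (\<integral>\<^sup>+w. (\<Prod>i<n. g (X i w) (mark i w) (bs i w) (fade i w) (bs0 w)) \<partial>P)"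
      by (intro nn_integral_cong) (auto simp: g_def split: split_indicator)
    also have "\<dots> = (\<integral>\<^sup>+t. \<integral>\<^sup>+w. (\<Prod>i<n. ennreal (1 - p t (X i w))) \<partial>P \<partial>boresight_law)"
      unfolding thinning[symmetric] by (rule nn_integral_marks[OF g_measurable])
    finally show ?thesis .
  qed

  \<comment> \<open>The events for the first \<open>n\<close> devices decrease to the event for all
    of them, so continuity from above applies.\<close>
  have "emeasure P {w\<in>space P. strongest_interference Pt Gm l \<alpha> \<phi> s w \<le> ereal \<Theta>} =
      emeasure P (\<Inter>n. {w \<in> space P. \<forall>i<n. \<not> hit (X i w) (mark i w) (bs i w) (fade i w) (bs0 w)})"
    unfolding strongest_interference_le_iff received_power_gt_iff[OF \<Theta>] hit_def audible_def a(1)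
    by (intro arg_cong[where f="emeasure P"]) auto
  also have "\<dots> = (INF n. emeasure P {w \<in> space P. \<forall>i<n. \<not> hit (X i w) (mark i w) (bs i w) (fade i w) (bs0 w)})"
    by (intro INF_emeasure_decseq[symmetric]) (auto simp: decseq_def)
  \<comment> \<open>The generating functional applies for fixed \<open>t\<close> only, so monotone
    convergence first moves the infimum inside the integral over the boresight.\<close>
  also have "\<dots> = (\<integral>\<^sup>+t. (INF n. \<integral>\<^sup>+w. (\<Prod>i<n. ennreal (1 - p t (X i w))) \<partial>P) \<partial>boresight_law)"
    unfolding fin_hit
  proof (rule nn_integral_monotone_convergence_INF_AE[symmetric])
    show "AE t in boresight_law. (\<integral>\<^sup>+w. (\<Prod>i<Suc n. ennreal (1 - p t (X i w))) \<partial>P) \<le>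
        (\<integral>\<^sup>+w. (\<Prod>i<n. ennreal (1 - p t (X i w))) \<partial>P)" for n
      using p01 by (intro AE_I2 nn_integral_mono decseq_SucD[OF decseq_prod_ennreal]) auto
    show "(\<integral>\<^sup>+t. \<integral>\<^sup>+w. (\<Prod>i<0. ennreal (1 - p t (X i w))) \<partial>P \<partial>boresight_law) < \<infinity>"
      by (simp add: emeasure_space_1 bl.emeasure_space_1[simplified])
    have [measurable]: "(\<lambda>(t, w). p t (X i w)) \<in> borel_measurable (borel \<Otimes>\<^sub>M P)" for i
      using \<phi> unfolding p_def indicator_def of_bool_def by measurable
    show "(\<lambda>t. \<integral>\<^sup>+w. (\<Prod>i<n. ennreal (1 - p t (X i w))) \<partial>P) \<in> borel_measurable boresight_law" for n
      by measurable
  qed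
  also have "\<dots> = (\<integral>\<^sup>+t. ennreal (exp (- (lam * \<Lambda>))) \<partial>boresight_law)"
  proof (intro nn_integral_cong)
    fix t
    have "(INF n. \<integral>\<^sup>+w. (\<Prod>i<n. ennreal (1 - p t (X i w))) \<partial>P) =
        ennreal (exp (- (lam * enn2real (\<integral>\<^sup>+x. ennreal (p t x) \<partial>lborel))))"
      using p_integral[of t] by (intro ppp_generating_functional prob_space_axioms ppp lam p01) auto
    then show "(INF n. \<integral>\<^sup>+w. (\<Prod>i<n. ennreal (1 - p t (X i w))) \<partial>P) = ennreal (exp (- (lam * \<Lambda>)))"
      using \<open>0 \<le> \<Lambda>\<close> by (simp only: p_integral enn2real_ennreal)
  qed
  also have "\<dots> = ennreal (exp (- (lam * \<Lambda>)))"
    using bl.emeasure_space_1 by (simp del: space_boresight_law)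
  finally have "strongest_interference_cdf Pt Gm l \<alpha> \<phi> s \<Theta> = exp (- (lam * \<Lambda>))"
    by (simp add: strongest_interference_cdf_def measure_def)
  then show ?thesis by (simp add: \<Lambda>_def)
qed

end

section \<open>Solving for the threshold\<close>

lemma threshold_equation_iff:
  fixes \<Theta> :: real
  assumes "M \<ge> 2" "\<delta> = 1 / real M" "0 < K" "0 < lam" "0 < \<phi>" "0 < \<alpha>" "0 < a" "0 < q" "q < 1"
  shows "0 < \<Theta> \<and> q = 1 - exp (- (lam * \<phi>\<^sup>2 * K / (4 * pi * real M) * (a / \<Theta>) powr (2 / \<alpha>))) ^ (M - 1)
    \<longleftrightarrow> \<Theta> = a * ((- K * (1 - \<delta>) * lam * \<phi>\<^sup>2) / (4 * pi * ln (1 - q))) powr (\<alpha> / 2)"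
proof -
  \<comment> \<open>Taking logarithms turns the equation into \<open>c * u = y\<close> with
    \<open>u = (a / \<Theta>) powr (2 / \<alpha>)\<close>. Both constants are positive, so raising
    to the power \<open>\<alpha> / 2\<close> can be undone; the positivity of \<Theta> on the left
    is recovered from the formula on the right.\<close>
  define c where "c = K * (1 - \<delta>) * lam * \<phi>\<^sup>2 / (4 * pi)"
  define y where "y = - ln (1 - q)"
  have "0 < c" using assms by (auto simp: c_def)
  have "0 < y" using assms by (simp add: y_def)
  have base: "(- K * (1 - \<delta>) * lam * \<phi>\<^sup>2) / (4 * pi * ln (1 - q)) = c / y"
    by (simp add: c_def y_def)
  have eq: "q = 1 - exp (- (lam * \<phi>\<^sup>2 * K / (4 * pi * real M) * u)) ^ (M - 1) \<longleftrightarrow> c * u = y" for u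
  proof -
    \<comment> \<open>The \<open>M - 1\<close> detection slots multiply the exponent, and
      \<open>(M - 1) / M = 1 - \<delta>\<close>.\<close>
    have "exp (- (lam * \<phi>\<^sup>2 * K / (4 * pi * real M) * u)) ^ (M - 1) = exp (- (c * u))"
      using assms(1,2) by (simp add: c_def of_nat_diff field_simps flip: exp_of_nat_mult)
    moreover have "1 - q = exp (- y)" using assms by (simp add: y_def)
    ultimately show ?thesis by auto
  qed
  show ?thesis
    unfolding base eq
  proof
    assume *: "0 < \<Theta> \<and> c * (a / \<Theta>) powr (2 / \<alpha>) = y"
    then have "(a / \<Theta>) powr (2 / \<alpha>) = y / c" using \<open>0 < c\<close> by (auto simp: field_simps)
    then have "((a / \<Theta>) powr (2 / \<alpha>)) powr (\<alpha> / 2) = (y / c) powr (\<alpha> / 2)" by simp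
    then have "a / \<Theta> = (y / c) powr (\<alpha> / 2)"
      using assms * by (simp add: powr_powr)
    then show "\<Theta> = a * (c / y) powr (\<alpha> / 2)"
      using \<open>0 < c\<close> \<open>0 < y\<close> * by (simp add: powr_divide field_simps)
  next
    assume \<Theta>: "\<Theta> = a * (c / y) powr (\<alpha> / 2)"
    then have "a / \<Theta> = (y / c) powr (\<alpha> / 2)"
      using assms \<open>0 < c\<close> \<open>0 < y\<close> by (simp add: powr_divide)
    then have "c * (a / \<Theta>) powr (2 / \<alpha>) = y"
      using assms \<open>0 < c\<close> \<open>0 < y\<close> by (simp add: powr_powr)
    then show "0 < \<Theta> \<and> c * (a / \<Theta>) powr (2 / \<alpha>) = y"
      using assms \<Theta> \<open>0 < c\<close> \<open>0 < y\<close> by simp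
  qed
qed

theorem mainTheorem2:
  fixes P :: "'w measure"
    and X :: "nat \<Rightarrow> 'w \<Rightarrow> real^2"
    and mark :: "nat \<Rightarrow> 'w \<Rightarrow> nat"
    and bs fade :: "nat \<Rightarrow> 'w \<Rightarrow> real"
    and bs0 :: "'w \<Rightarrow> real"
    and fad :: fading
    and lam \<delta> \<phi> \<alpha> Pt Gm l \<omega> Pfa \<Theta> :: real
    and M mark0 s :: nat
  assumes network: "radar_network P lam M fad X mark bs fade bs0"
    and "lam > 0" and "M \<ge> 2" and "\<delta> = 1 / real M"
    and "0 < \<phi>" and "\<phi> \<le> 2 * pi" and "\<alpha> > 2"
    and "Pt > 0" and "Gm > 0" and "l > 0" and "\<omega> = Pt * Gm ^ 2 * l"
    and "0 < Pfa" and "Pfa < 1"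
    and receiver_mark: "mark0 < M"
    and detection_slot: "\<not> transmits_in M mark0 s"
  shows "(\<Theta> > 0 \<and>
          Pfa = 1 - radar_network.strongest_interference_cdf P M X mark bs fade bs0
                      Pt Gm l \<alpha> \<phi> s \<Theta> ^ (M - 1))
     \<longleftrightarrow> \<Theta> = \<omega> * ((- fading_const \<alpha> fad * (1 - \<delta>) * lam * \<phi> ^ 2) /
                (4 * pi * ln (1 - Pfa))) powr (\<alpha> / 2)"
proof -
  interpret radar_network P lam M fad X mark bs fade bs0 by fact
  have "0 < \<omega>" using assms by simp
  have "0 < fading_const \<alpha> fad"
    using \<open>\<alpha> > 2\<close> by (intro fading_const_pos) simp
  then have "(\<Theta> > 0 \<and> Pfa = 1 - exp (- (lam * \<phi>\<^sup>2 * fading_const \<alpha> fad / (4 * pi * real M) *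
        (\<omega> / \<Theta>) powr (2 / \<alpha>))) ^ (M - 1))
     \<longleftrightarrow> \<Theta> = \<omega> * ((- fading_const \<alpha> fad * (1 - \<delta>) * lam * \<phi> ^ 2) /
                (4 * pi * ln (1 - Pfa))) powr (\<alpha> / 2)"
    using assms \<open>0 < \<omega>\<close> by (intro threshold_equation_iff) auto
  \<comment> \<open>The distribution function is known for positive thresholds only. For other
    \<Theta> both sides of the claim are false, the right one by the equivalence just
    obtained.\<close>
  moreover have "strongest_interference_cdf Pt Gm l \<alpha> \<phi> s \<Theta> =
      exp (- (lam * \<phi>\<^sup>2 * fading_const \<alpha> fad / (4 * pi * real M) * (\<omega> / \<Theta>) powr (2 / \<alpha>)))" if "\<Theta> > 0"
    using assms \<open>0 < \<omega>\<close> that by (intro strongest_interference_cdf_eq) auto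
  ultimately show ?thesis by auto
qed

end
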